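(* Let the pair $0\le(f,n_c)\in\mathcal C([0,\infty);\mathcal S)\times\mathcal C([0,\infty))$ be the solution of $$\frac{df}{dt}=\frac{\kappa_0}{n_c}\mathcal Q[f],\quad f(0,\cdot)=f_0,\qquad \frac{dn_c}{dt}=-\frac{\kappa_0}{n_c}\int \mathcal Q[f]\,dp,\quad n_c(0)=n_0,$$ associated to an initial condition $(f_0,n_0)>0$ satisfying $n_0\ge\mathcal C(f_0)-m_2\langle f_0\rangle+\delta$ for some $\delta>0$. Take $a\in[1,\infty)$ and suppose that there exists $\alpha_0>0$ such that $$\int_{\mathbb R^3}f_0(p)\,\mathcal E_a(\alpha_0^a|p|)\,dp\le1 .$$ Then there exists a positive constant $\alpha=\alpha(\mathcal M_1(0),\alpha_0,a)$, where $\mathcal M_1(0)=\int_{\mathbb R^3}f_0(p)|p|\,dp$, such that $$\sup_{t\ge0}\int_{\mathbb R^3}f(t,p)\,\mathcal E_a(\alpha^a|p|)\,dp\le2 .$$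
   Context: For $a\in[1,\infty)$, $\mathcal E_a(x):=\sum_{k=1}^\infty\frac{x^k}{\Gamma(ak+1)}$ (sum starting at $k=1$). Radial functions on $\mathbb R^3$ are identified with functions of $r=|p|\ge0$. Line-moments: $m_k\langle f\rangle=\int_0^\infty f(r)r^k\,dr$. Collision operator. The underlying operator is $\mathcal Q[f](p)=\iint_{\mathbb R^3\times\mathbb R^3}[R(p,p_1,p_2)-R(p_1,p,p_2)-R(p_2,p_1,p)]\,dp_1dp_2$ with $R(p,p_1,p_2)=|p||p_1||p_2|\,\delta(|p|-|p_1|-|p_2|)\delta(p-p_1-p_2)[f(p_1)f(p_2)(1+f(p))-(1+f(p_1))(1+f(p_2))f(p)]$. For radial $f$ it takes the following form, with numerical factors ($8\pi^2$, $4\pi$) absorbed in the normalization of $\kappa_0$ and $n_c$. With $K(r,s)=r^2s^2(r+s)^2$, $$\mathcal Q_q[f](r)=\int_0^rK(s,r-s)f(s)f(r-s)\,ds+2\int_r^\infty K(r,s-r)f(s)f(s-r)\,ds+2f(r)\Big(\int_r^\infty K(r,s-r)f(s)\,ds-\int_0^rK(s,r-s)f(s)\,ds-\int_0^\infty K(r,s)f(s)\,ds\Big),$$ $$\mathcal L[f](r)=2\int_r^\infty K(r,s-r)f(s)\,ds-f(r)\int_0^rK(s,r-s)\,ds,$$ $$\mathcal Q[f](r):=r^{-2}\big(\mathcal Q_q[f](r)+\mathcal L[f](r)\big).$$ In the equation for $n_c$, $\int\mathcal Q[f]\,dp:=\int_0^\infty\mathcal Q[f](r)\,r^2dr$. $\kappa_0>0$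 is a fixed constant. The set $\mathcal S$. It consists of all $f\in L^1(\mathbb R^3,dp)$ that are nonnegative and radially symmetric, with $m_3\langle f\rangle=\mathfrak h_3$, $m_8\langle f\rangle\le\mathfrak h_8$ and $\|f(\cdot)|\cdot|^2\|_{L^\infty}\le\mathfrak h_\infty$. Here $\mathfrak h_3>0$, $\mathfrak h_8:=2\mathfrak h_*+\frac{\kappa_0}{\delta}\tilde C_8\,\mathfrak h_3^{7/2}$, $\mathfrak h_*:=(\tilde C_8/\tilde c_8)^{1/2}\mathfrak h_3^{9/4}$, where $\tilde C_8,\tilde c_8>0$ are fixed universal constants such that $\int_0^\infty\mathcal Q[g](r)r^8dr\le m_3\langle g\rangle^{-1}\big(\tilde C_8\,m_3\langle g\rangle^{9/2}-\tilde c_8\,m_8\langle g\rangle^2\big)$ for all radial $g\ge0$ with finite line-moments, and $\mathfrak h_\infty$ is taken sufficiently large depending only on $\mathfrak h_3,\mathfrak h_8$. Threshold. With $c_0=\int_0^1z^2(1-z)^2dz$ and $m_3=m_3\langle f_0\rangle$, $$\mathcal C(f_0)=2\sqrt{m_3\max\Big\{\|f_0(\cdot)|\cdot|^2\|_{L^\infty},\ \frac{3\max\{m_4\langle f_0\rangle,\,C\,m_3^{5/4}\}}{2\,c_0^{1/4}m_3^{3/4}}\Big\}},$$ where $C>0$ is a fixed universal constant such that solutions satisfy $\sup_t m_4\langle f(t)\rangle\le\max\{m_4\langle f_0\rangle,C m_3^{5/4}\}$ as long as $n_c>0$. Under the threshold condition the solution satisfies $n_c(t)\ge\delta$ for all $t\ge0$.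 *)

theory Defs
  imports "HOL-Analysis.Analysis" "HOL-Probability.Essential_Supremum"
begin

text \<open>
  A radial function on three-dimensional space is represented by its profile
  \<open>f :: real \<Rightarrow> real\<close>; only the values at radii \<open>r \<ge> 0\<close> matter, and the function itself
  is \<open>lift3 f\<close>. Profiles are representatives of classes in \<open>L\<^sup>1\<close>, so sign conditions are
  almost-everywhere conditions.
\<close>

definition lift3 :: "(real \<Rightarrow> real) \<Rightarrow> real ^ 3 \<Rightarrow> real" where
  "lift3 f p = f (norm p)"

definition mittag_leffler :: "real \<Rightarrow> real \<Rightarrow> real" where
  "mittag_leffler a x = (\<Sum>k. x ^ Suc k / Gamma (a * real (Suc k) + 1))"

definition finite_moment :: "nat \<Rightarrow> (real \<Rightarrow> real) \<Rightarrow> bool" where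
  "finite_moment k f \<longleftrightarrow> set_integrable lborel {0..} (\<lambda>r. f r * r ^ k)"

definition line_moment :: "nat \<Rightarrow> (real \<Rightarrow> real) \<Rightarrow> real" where
  "line_moment k f = (LBINT r:{0..}. f r * r ^ k)"

definition energy :: "(real \<Rightarrow> real) \<Rightarrow> real" where
  "energy f = (\<integral>p. lift3 f p * norm p \<partial>lborel)"

text \<open>For \<open>f\<close> nonnegative almost everywhere this is the integral of \<open>f\<close> against
  the weight \<open>mittag_leffler a (\<beta>\<^sup>a |p|)\<close>, with value \<open>\<infinity>\<close> if it diverges.\<close>

definition ml_integral :: "real \<Rightarrow> real \<Rightarrow> (real \<Rightarrow> real) \<Rightarrow> ennreal" where
  "ml_integral a \<beta> f =
     (\<integral>\<^sup>+p. ennreal (lift3 f p * mittag_leffler a (\<beta> powr a * norm p)) \<partial>lborel)"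

definition L1_norm :: "(real \<Rightarrow> real) \<Rightarrow> ennreal" where
  "L1_norm f = (\<integral>\<^sup>+p. ennreal \<bar>lift3 f p\<bar> \<partial>lborel)"

definition weighted_Linf :: "(real \<Rightarrow> real) \<Rightarrow> ereal" where
  "weighted_Linf f = esssup lborel (\<lambda>p. ereal \<bar>lift3 f p * (norm p)\<^sup>2\<bar>)"

definition coll_kernel :: "real \<Rightarrow> real \<Rightarrow> real" where
  "coll_kernel r s = r\<^sup>2 * s\<^sup>2 * (r + s)\<^sup>2"

definition quad_coll :: "(real \<Rightarrow> real) \<Rightarrow> real \<Rightarrow> real" where
  "quad_coll f r =
     (LBINT s:{0..r}. coll_kernel s (r - s) * f s * f (r - s))
     + 2 * (LBINT s:{r..}. coll_kernel r (s - r) * f s * f (s - r))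
     + 2 * f r * ((LBINT s:{r..}. coll_kernel r (s - r) * f s)
                  - (LBINT s:{0..r}. coll_kernel s (r - s) * f s)
                  - (LBINT s:{0..}. coll_kernel r s * f s))"

definition lin_coll :: "(real \<Rightarrow> real) \<Rightarrow> real \<Rightarrow> real" where
  "lin_coll f r =
     2 * (LBINT s:{r..}. coll_kernel r (s - r) * f s)
     - f r * (LBINT s:{0..r}. coll_kernel s (r - s))"

definition coll :: "(real \<Rightarrow> real) \<Rightarrow> real \<Rightarrow> real" where
  "coll f r = (quad_coll f r + lin_coll f r) / r\<^sup>2"

text \<open>Integrability of the eighth moment is stated separately because the Lebesgue integral
  of a non-integrable function is \<open>0\<close> by convention; integrability of the third moment
  then follows from that of \<open>lift3 f\<close>.\<close>

definition invariant_set :: "real \<Rightarrow> real \<Rightarrow> real \<Rightarrow> (real \<Rightarrow> real) set" where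
  "invariant_set h3 h8 hinf =
     {f. integrable lborel (lift3 f) \<and> (AE p in lborel. 0 \<le> lift3 f p) \<and>
         line_moment 3 f = h3 \<and>
         finite_moment 8 f \<and> line_moment 8 f \<le> h8 \<and>
         weighted_Linf f \<le> ereal hinf}"

text \<open>Solutions of the system on a time interval \<open>J\<close> with left end point \<open>0\<close>:
  \<open>f\<close> is continuous in \<open>L\<^sup>1\<close> with values in \<open>X\<close>, its time derivative at positive times is the
  limit of difference quotients in \<open>L\<^sup>1\<close>, and the condensate density stays positive
  (so that the factor \<open>\<kappa>0 / n\<^sub>c\<close> is meaningful).\<close>

definition bec_solution ::
    "real \<Rightarrow> real set \<Rightarrow> (real \<Rightarrow> real) set \<Rightarrow> (real \<Rightarrow> real \<Rightarrow> real) \<Rightarrow> (real \<Rightarrow> real) \<Rightarrow> bool" where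
  "bec_solution \<kappa>0 J X f nc \<longleftrightarrow>
     (\<forall>t\<in>J. f t \<in> X) \<and> (\<forall>t\<in>J. 0 < nc t) \<and>
     (\<forall>t\<in>J. ((\<lambda>s. L1_norm (\<lambda>r. f s r - f t r)) \<longlongrightarrow> 0) (at t within J)) \<and>
     continuous_on J nc \<and>
     (\<forall>t\<in>J. 0 < t \<longrightarrow>
        ((\<lambda>s. L1_norm (\<lambda>r. (f s r - f t r) / (s - t) - \<kappa>0 / nc t * coll (f t) r)) \<longlongrightarrow> 0)
          (at t within J)) \<and>
     (\<forall>t\<in>J. 0 < t \<longrightarrow>
        (nc has_real_derivative - (\<kappa>0 / nc t) * (LBINT r:{0..}. coll (f t) r * r\<^sup>2))
          (at t within J))"

definition m8_constants :: "real \<Rightarrow> real \<Rightarrow> bool" where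
  "m8_constants C8 c8 \<longleftrightarrow> 0 < C8 \<and> 0 < c8 \<and>
     (\<forall>g. (AE p in lborel. 0 \<le> lift3 g p) \<and> (\<forall>k. finite_moment k g) \<longrightarrow>
        (LBINT r:{0..}. coll g r * r ^ 8)
          \<le> (C8 * line_moment 3 g powr (9 / 2) - c8 * (line_moment 8 g)\<^sup>2) / line_moment 3 g)"

definition h_star :: "real \<Rightarrow> real \<Rightarrow> real \<Rightarrow> real" where
  "h_star C8 c8 h3 = sqrt (C8 / c8) * h3 powr (9 / 4)"

definition h8_bound :: "real \<Rightarrow> real \<Rightarrow> real \<Rightarrow> real \<Rightarrow> real \<Rightarrow> real" where
  "h8_bound \<kappa>0 \<delta> C8 c8 h3 = 2 * h_star C8 c8 h3 + \<kappa>0 / \<delta> * C8 * h3 powr (7 / 2)"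

definition m4_constant :: "real \<Rightarrow> bool" where
  "m4_constant C \<longleftrightarrow> 0 < C \<and>
     (\<forall>\<kappa>0 h3 h8 hinf T f nc.
        0 < \<kappa>0 \<and> 0 < h3 \<and> 0 < T \<and>
        bec_solution \<kappa>0 {0..<T} (invariant_set h3 h8 hinf) f nc \<longrightarrow>
        (\<forall>t\<in>{0..<T}. line_moment 4 (f t)
           \<le> max (line_moment 4 (f 0)) (C * line_moment 3 (f 0) powr (5 / 4))))"

definition c_zero :: real where
  "c_zero = (LBINT z:{0..1}. z\<^sup>2 * (1 - z)\<^sup>2)"

definition threshold :: "real \<Rightarrow> (real \<Rightarrow> real) \<Rightarrow> real" where
  "threshold C f0 =
     2 * sqrt (line_moment 3 f0 *
       max (real_of_ereal (weighted_Linf f0))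
           (3 * max (line_moment 4 f0) (C * line_moment 3 f0 powr (5 / 4))
             / (2 * c_zero powr (1 / 4) * line_moment 3 f0 powr (3 / 4))))"

end

theory Submission
  imports Defs
begin

text \<open>
  For \<open>\<phi>(r) = mittag_leffler a (\<beta> r)\<close> the weak form of the equation reads, up to \<open>\<kappa>\<^sub>0 / n\<^sub>c\<close>,
  \<open>d/dt \<integral> f \<phi> r\<^sup>2 dr = \<integral>\<integral> K(x,y) [f(x) f(y) - f(x+y) (1 + f(x) + f(y))] D\<phi>(x,y) dx dy\<close> with
  \<open>D\<phi>(x,y) = \<phi>(x+y) - \<phi>(x) - \<phi>(y) \<ge> 0\<close>. Monotonicity in \<open>a\<close> of
  \<open>\<Gamma>(ai+1) \<Gamma>(aj+1) / \<Gamma>(a(i+j)+1)\<close> gives \<open>D\<phi>(x,y) \<le> \<phi>(x) \<phi>(y)\<close>, so the gain is at most a multiple of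
  \<open>(\<integral> f \<phi> r\<^sup>2) (\<integral> f \<phi> r\<^sup>4)\<close>, whereas the linear loss controls \<open>A \<integral> f \<phi> r\<^sup>4\<close> over \<open>r \<ge> R\<^sub>0 = \<beta>\<^sup>-\<^sup>1\<^sup>/\<^sup>2\<close>
  with \<open>A\<close> of order \<open>1 / \<beta>\<close>. The contribution of \<open>r \<le> R\<^sub>0\<close> is bounded by the conserved third moment,
  hence for small \<open>\<beta>\<close> the weighted mass cannot grow while it lies between 1 and 2.

  A priori only eight moments are finite, so \<open>\<phi>\<close> is replaced beyond \<open>N\<close> by its tangent line. The
  tangent extension differs from a multiple of \<open>r\<close>, whose integral is conserved, by a bounded function,
  which may be tested against the \<open>L\<^sup>1\<close> derivative; superadditivity and both bounds survive
  uniformly in \<open>N\<close>.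
\<close>

section \<open>Superadditive power series and their tangent extensions\<close>

text \<open>The logarithm of \<open>Gamma (c * x + 1) * Gamma (c * y + 1) / Gamma (c * (x + y) +
  1)\<close> has nonpositive derivative in \<open>c\<close>, because \<open>Digamma\<close> is
  increasing on the positive reals. At \<open>c = 1\<close> and integer arguments the quotient is a
  reciprocal binomial coefficient, which is how the inequality yields
  \<open>b_submult\<close>.\<close>

lemma Gamma_product_le:
  fixes x y a :: real
  assumes "0 \<le> x" "0 \<le> y" "1 \<le> a"
  shows "Gamma (a * x + 1) * Gamma (a * y + 1) * Gamma (x + y + 1)
    \<le> Gamma (x + 1) * Gamma (y + 1) * Gamma (a * (x + y) + 1)"
proof -
  define h where "h c = ln_Gamma (c * x + 1) + ln_Gamma (c * y + 1) - ln_Gamma (c * (x + y) + 1)"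
    for c :: real
  have "h a \<le> h 1"
  proof (rule DERIV_nonpos_imp_nonincreasing[OF assms(3)])
    fix c :: real assume c: "1 \<le> c" "c \<le> a"
    have pos: "0 < c * x + 1" "0 < c * y + 1" "0 < c * (x + y) + 1"
      using c assms by (auto intro!: add_nonneg_pos mult_nonneg_nonneg)
    have "(h has_real_derivative x * (Digamma (c * x + 1) - Digamma (c * (x + y) + 1))
        + y * (Digamma (c * y + 1) - Digamma (c * (x + y) + 1))) (at c)"
      unfolding h_def using pos
      by (auto intro!: derivative_eq_intros simp: algebra_simps)
    moreover have "Digamma (c * x + 1) \<le> Digamma (c * (x + y) + 1)"
      "Digamma (c * y + 1) \<le> Digamma (c * (x + y) + 1)"
      using pos c assms by (auto intro!: Digamma_real_mono mult_left_mono)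
    ultimately show "\<exists>d. (h has_real_derivative d) (at c) \<and> d \<le> 0"
      using assms by (auto intro!: exI add_nonpos_nonpos mult_nonneg_nonpos)
  qed
  moreover have pos: "0 < a * x + 1" "0 < a * y + 1" "0 < a * (x + y) + 1"
    using assms by (auto intro!: add_nonneg_pos mult_nonneg_nonneg)
  ultimately have "ln_Gamma (a * x + 1) + ln_Gamma (a * y + 1) + ln_Gamma (x + y + 1)
    \<le> ln_Gamma (x + 1) + ln_Gamma (y + 1) + ln_Gamma (a * (x + y) + 1)"
    by (simp add: h_def)
  then have "exp (ln_Gamma (a * x + 1) + ln_Gamma (a * y + 1) + ln_Gamma (x + y + 1))
    \<le> exp (ln_Gamma (x + 1) + ln_Gamma (y + 1) + ln_Gamma (a * (x + y) + 1))"
    by simp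
  then show ?thesis
    using pos assms by (simp add: exp_add Gamma_real_pos_exp)
qed

text \<open>Convexity of powers on the half-line. Summed over the series it gives
  \<open>\<phi>_tangent\<close>.\<close>

lemma power_tangent_le:
  fixes x r :: real
  assumes "0 \<le> x" "x \<le> r"
  shows "x ^ Suc k + real (Suc k) * x ^ k * (r - x) \<le> r ^ Suc k"
proof (induction k)
  case (Suc k)
  have "x ^ Suc (Suc k) + real (Suc (Suc k)) * x ^ Suc k * (r - x)
    = x * (x ^ Suc k + real (Suc k) * x ^ k * (r - x)) + x ^ Suc k * (r - x)"
    by (simp add: algebra_simps)
  also have "\<dots> \<le> x * r ^ Suc k + r ^ Suc k * (r - x)"
    using assms Suc by (intro add_mono mult_left_mono mult_right_mono power_mono) auto
  also have "\<dots> = r ^ Suc (Suc k)" by (simp add: algebra_simps)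
  finally show ?case .
qed simp

section \<open>Starshaped functions and their affine continuation beyond \<open>N\<close>\<close>

definition linear_extension :: "real \<Rightarrow> real \<Rightarrow> (real \<Rightarrow> real) \<Rightarrow> real \<Rightarrow> real" where
  "linear_extension s N f r = (if r \<le> N then f r else f N + s * (r - N))"

text \<open>The property is that \<open>f x / x\<close> is nondecreasing, written without division
  so that \<open>x = 0\<close> is covered. The affine branch divided by \<open>r\<close> is
  \<open>s - (s * N - f N) / r\<close>, which increases because \<open>f N \<le> s * N\<close>;
  points on opposite sides of \<open>N\<close> are compared through \<open>N\<close>.\<close>

lemma linear_extension_starshaped:
  assumes star: "\<And>x y. 0 \<le> x \<Longrightarrow> x \<le> y \<Longrightarrow> y * f x \<le> x * f y"
    and N: "0 < N" "f N \<le> s * N" and xy: "0 \<le> x" "x \<le> y"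
  shows "y * linear_extension s N f x \<le> x * linear_extension s N f y"
proof -
  have *: "y * linear_extension s N f x \<le> x * linear_extension s N f y" if "N \<le> x" "x \<le> y" for x y
  proof -
    have "x * (s * y - (s * N - f N)) - y * (s * x - (s * N - f N)) = (y - x) * (s * N - f N)"
      by (simp add: algebra_simps)
    also have "\<dots> \<ge> 0" using that N by simp
    finally show ?thesis
      using that by (cases "x = N"; cases "y = N") (auto simp: linear_extension_def algebra_simps)
  qed
  consider "y \<le> N" | "N \<le> x" | "x \<le> N" "N \<le> y" using xy by linarith
  then show ?thesis
  proof cases
    case 1
    then show ?thesis using star[OF xy] xy by (simp add: linear_extension_def)
  next
    case 2
    then show ?thesis using * xy by blast
  next
    case 3
    have "N * (y * linear_extension s N f x) = y * (N * f x)"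
      using 3 by (simp add: linear_extension_def algebra_simps)
    also have "\<dots> \<le> y * (x * f N)" using star[of x N] 3 xy by (intro mult_left_mono) auto
    also have "\<dots> = x * (y * linear_extension s N f N)" by (simp add: linear_extension_def algebra_simps)
    also have "\<dots> \<le> x * (N * linear_extension s N f y)"
      using *[of N y] 3 xy by (intro mult_left_mono) auto
    finally have "N * (y * linear_extension s N f x) \<le> N * (x * linear_extension s N f y)"
      by (simp add: algebra_simps)
    then show ?thesis using N by simp
  qed
qed

text \<open>Each of \<open>f x\<close> and \<open>f y\<close> is at most its proportional share,
  \<open>x / (x + y)\<close> or \<open>y / (x + y)\<close>, of \<open>f (x + y)\<close>.\<close>

lemma starshaped_superadditive:
  fixes f :: "real \<Rightarrow> real"
  assumes star: "\<And>x y. 0 \<le> x \<Longrightarrow> x \<le> y \<Longrightarrow> y * f x \<le> x * f y"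
    and xy: "0 \<le> x" "0 \<le> y"
  shows "f x + f y \<le> f (x + y)"
proof (cases "x + y = 0")
  case True
  then have "x = 0" "y = 0" using xy by auto
  \<comment> \<open>The hypothesis at 0 and 1 gives \<open>f 0 \<le> 0\<close>, which is all that
    the claim says at the origin.\<close>
  then show ?thesis using star[of 0 1] by simp
next
  case False
  then have "0 < x + y" using xy by auto
  moreover have "(x + y) * (f x + f y) \<le> (x + y) * f (x + y)"
    using star[of x "x + y"] star[of y "x + y"] xy by (simp add: algebra_simps)
  ultimately show ?thesis by simp
qed

text \<open>For a starshaped extension, two pieces of size at most \<open>2 * R / 3\<close> adding
  up to \<open>R\<close> contribute at most \<open>3 / 2\<close> times the value at
  \<open>2 * R / 3\<close>, so this is a lower bound for the defect. Below \<open>N\<close>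
  quadratic growth leaves a fixed fraction of the value at \<open>R\<close>; an affine function has
  a constant defect, hence the factor \<open>N / R\<close> beyond.\<close>

lemma linear_extension_two_thirds:
  assumes N: "0 < N" "0 \<le> f N" "2 * f N \<le> s * N" and R: "0 < R"
    and quad: "\<And>x y. 0 \<le> x \<Longrightarrow> x \<le> y \<Longrightarrow> y\<^sup>2 * f x \<le> x\<^sup>2 * f y"
    and nonneg: "\<And>x. 0 \<le> x \<Longrightarrow> 0 \<le> f x"
  shows "min 1 (N / R) * linear_extension s N f R / 4
    \<le> linear_extension s N f R - 3 / 2 * linear_extension s N f (2 * R / 3)"
    (is "?m * ?E R / 4 \<le> _")
proof -
  consider "R \<le> N" | "N < R" "2 * R / 3 \<le> N" | "N < 2 * R / 3" by linarith
  then show ?thesis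
  proof cases
    case 1
    then have m: "?m = 1" and E: "?E R = f R" "?E (2 * R / 3) = f (2 * R / 3)"
      using R by (auto simp: linear_extension_def)
    \<comment> \<open>Since \<open>3 / 2 * (4 / 9) = 2 / 3\<close>, a third of \<open>f R\<close>
      remains, more than the quarter required.\<close>
    have "R\<^sup>2 * f (2 * R / 3) \<le> R\<^sup>2 * (4 / 9 * f R)"
      using quad[of "2 * R / 3" R] R by (simp add: power2_eq_square)
    then have "f (2 * R / 3) \<le> 4 / 9 * f R" using R by simp
    then show ?thesis using nonneg[of R] R unfolding m E by simp
  next
    case 2
    have E: "?E R = f N + s * (R - N)" "?E (2 * R / 3) = f (2 * R / 3)"
      using 2 by (auto simp: linear_extension_def)
    have "2 * f N * (R - N) \<le> s * N * (R - N)" using N 2 by (intro mult_right_mono) auto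
    then have ER: "f N * (2 * R - N) \<le> N * ?E R" unfolding E by (simp add: algebra_simps)
    have "N\<^sup>2 * f (2 * R / 3) \<le> 4 / 9 * R\<^sup>2 * f N"
      using quad[of "2 * R / 3" N] 2 R by (simp add: power2_eq_square)
    then have "N\<^sup>2 * (3 / 2 * f (2 * R / 3)) \<le> 2 / 3 * R\<^sup>2 * f N" by simp
    \<comment> \<open>Here \<open>N < R \<le> 3 / 2 * N\<close>. The difference of the two sides is
      concave in \<open>R\<close>, positive at \<open>R = N\<close> and zero at
      \<open>R = 3 / 2 * N\<close>; the products below certify its sign.\<close>
    also have "2 / 3 * R\<^sup>2 \<le> 3 / 4 * N * (2 * R - N)"
    proof -
      have "0 \<le> (R - N) * (3 / 2 * N - R)" using 2 by (intro mult_nonneg_nonneg) auto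
      moreover have "0 \<le> N * (3/2 * N - R)" using 2 N by (intro mult_nonneg_nonneg) auto
      moreover have "0 \<le> R * (3/2 * N - R)" using 2 R by (intro mult_nonneg_nonneg) auto
      moreover have "0 \<le> N * (R - N)" using 2 N by (intro mult_nonneg_nonneg) auto
      ultimately show ?thesis by (simp add: power2_eq_square field_simps)
    qed
    then have "2 / 3 * R\<^sup>2 * f N \<le> 3 / 4 * N * (2 * R - N) * f N" using N by (intro mult_right_mono) auto
    also have "\<dots> \<le> 3 / 4 * N * (N * ?E R)"
      using mult_left_mono[OF ER, of "3 / 4 * N"] N by (simp add: algebra_simps)
    finally have "N\<^sup>2 * (3 / 2 * f (2 * R / 3)) \<le> N\<^sup>2 * (3 / 4 * ?E R)"
      by (simp add: power2_eq_square)
    then have "3 / 2 * ?E (2 * R / 3) \<le> 3 / 4 * ?E R" using N E by simp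
    moreover have "?m * ?E R \<le> 1 * ?E R"
    proof (intro mult_right_mono)
      have "0 \<le> N * ?E R" using ER N 2 by (smt (verit) mult_nonneg_nonneg)
      then show "0 \<le> ?E R" using N by (simp add: zero_le_mult_iff)
    qed auto
    ultimately show ?thesis by simp
  next
    case 3
    have NR: "N < R" using 3 R by linarith
    have E: "?E R = f N + s * (R - N)" "?E (2 * R / 3) = f N + s * (2 * R / 3 - N)"
      using 3 NR by (auto simp: linear_extension_def)
    \<comment> \<open>Both points lie on the affine branch, where the left side is at most
      \<open>s * N / 4\<close> and the defect is \<open>(s * N - f N) / 2\<close>; the hypothesis
      \<open>2 * f N \<le> s * N\<close> compares them.\<close>
    have "?m * ?E R \<le> (N / R) * (s * R)"
    proof (intro mult_mono)
      have s: "0 \<le> s" using N by (smt (verit) mult_nonneg_nonneg zero_le_mult_iff)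
      show "?E R \<le> s * R" using N unfolding E by (simp add: algebra_simps)
      show "0 \<le> ?E R" using N s NR unfolding E by simp
      show "0 \<le> N / R" using N R by simp
    qed auto
    then have "?m * ?E R \<le> s * N" using R by (simp add: mult.commute)
    moreover have "?E R - 3 / 2 * ?E (2 * R / 3) = (s * N - f N) / 2"
      unfolding E by (simp add: algebra_simps)
    ultimately show ?thesis using N by simp
  qed
qed

text \<open>The coefficient \<open>b k\<close> belongs to degree \<open>k + 1\<close>. In terms of
  degrees, \<open>b_submult\<close> says that \<open>n!\<close> times the coefficient of degree
  \<open>n\<close> is submultiplicative in \<open>n\<close>, with equality for the exponential
  series.\<close>

locale series_weight =
  fixes b :: "nat \<Rightarrow> real"
  assumes b_pos: "0 < b k"
    and b_summable: "summable (\<lambda>k. b k * r ^ k)"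
    and b_submult: "real ((i + j + 2) choose (i + 1)) * b (i + j + 1) \<le> b i * b j"
begin

definition \<phi> :: "real \<Rightarrow> real" where "\<phi> r = (\<Sum>k. b k * r ^ Suc k)"

text \<open>This is \<open>\<phi>\<close> without its linear term. A linear weight has no defect, so
  lower bounds on the defect can only see degrees two and higher.\<close>

definition \<psi> :: "real \<Rightarrow> real" where "\<psi> r = (\<Sum>k. b (Suc k) * r ^ Suc (Suc k))"

text \<open>The term-by-term derivative of \<open>\<phi>\<close>, hence its tangent slope at
  \<open>N\<close>; \<open>slope N - b 0\<close> is the tangent slope of
  \<open>\<psi>\<close>.\<close>

definition slope :: "real \<Rightarrow> real" where "slope N = (\<Sum>k. b k * (real (Suc k) * N ^ k))"

lemma \<phi>_summable: "summable (\<lambda>k. b k * r ^ Suc k)"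
  using summable_mult[OF b_summable[of r], of r] by (simp add: algebra_simps)

lemma \<psi>_summable: "summable (\<lambda>k. b (Suc k) * r ^ Suc (Suc k))"
  using \<phi>_summable by (subst summable_Suc_iff[of "\<lambda>k. b k * r ^ Suc k"])

lemma slope_summable: "summable (\<lambda>k. b k * (real (Suc k) * N ^ k))"
proof -
  \<comment> \<open>Shifting the index so that \<open>c n\<close> has degree \<open>n\<close> makes
    \<open>slope\<close> the differentiated power series of \<open>c\<close>.\<close>
  define c where "c n = (if n = 0 then 0 else b (n - 1))" for n
  have "summable (\<lambda>n. c n * x ^ n)" for x
    using \<phi>_summable[of x] by (subst summable_Suc_iff[symmetric]) (simp add: c_def)
  then have "summable (\<lambda>n. diffs c n * N ^ n)" by (rule termdiff_converges_all)
  then show ?thesis by (simp add: diffs_def c_def algebra_simps)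
qed

lemma \<phi>_eq: "\<phi> r = b 0 * r + \<psi> r"
  unfolding \<phi>_def \<psi>_def using suminf_split_head[OF \<phi>_summable[of r]] by simp

lemma \<phi>_nonneg: "0 \<le> r \<Longrightarrow> 0 \<le> \<phi> r"
  unfolding \<phi>_def using b_pos by (intro suminf_nonneg \<phi>_summable) (auto simp: less_imp_le)

lemma \<psi>_nonneg: "0 \<le> r \<Longrightarrow> 0 \<le> \<psi> r"
  unfolding \<psi>_def using b_pos by (intro suminf_nonneg \<psi>_summable) (auto simp: less_imp_le)

lemma \<phi>_mono: "0 \<le> x \<Longrightarrow> x \<le> y \<Longrightarrow> \<phi> x \<le> \<phi> y"
  unfolding \<phi>_def using b_pos
  by (intro suminf_le \<phi>_summable mult_left_mono power_mono) (auto intro: less_imp_le)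

lemma \<phi>_starshaped:
  assumes "0 \<le> x" "x \<le> y"
  shows "y * \<phi> x \<le> x * \<phi> y"
proof -
  have "(\<Sum>k. y * (b k * x ^ Suc k)) \<le> (\<Sum>k. x * (b k * y ^ Suc k))"
  proof (intro suminf_le summable_mult \<phi>_summable)
    fix k
    have "b k * x * y * x ^ k \<le> b k * x * y * y ^ k"
      using b_pos[of k] assms by (intro mult_left_mono power_mono) auto
    then show "y * (b k * x ^ Suc k) \<le> x * (b k * y ^ Suc k)" by (simp add: algebra_simps)
  qed
  then show ?thesis unfolding \<phi>_def by (simp only: suminf_mult[OF \<phi>_summable])
qed

text \<open>All degrees in \<open>\<psi>\<close> are at least two, so \<open>\<psi> r / r^2\<close>
  is nondecreasing term by term.\<close>

lemma \<psi>_quadratic: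
  assumes "0 \<le> x" "x \<le> y"
  shows "y\<^sup>2 * \<psi> x \<le> x\<^sup>2 * \<psi> y"
proof -
  have "(\<Sum>k. y\<^sup>2 * (b (Suc k) * x ^ Suc (Suc k))) \<le> (\<Sum>k. x\<^sup>2 * (b (Suc k) * y ^ Suc (Suc k)))"
  proof (intro suminf_le summable_mult \<psi>_summable)
    fix k
    have "b (Suc k) * x\<^sup>2 * y\<^sup>2 * x ^ k \<le> b (Suc k) * x\<^sup>2 * y\<^sup>2 * y ^ k"
      using b_pos[of "Suc k"] assms by (intro mult_left_mono power_mono) auto
    then show "y\<^sup>2 * (b (Suc k) * x ^ Suc (Suc k)) \<le> x\<^sup>2 * (b (Suc k) * y ^ Suc (Suc k))"
      by (simp add: algebra_simps power2_eq_square)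
  qed
  then show ?thesis unfolding \<psi>_def by (simp only: suminf_mult[OF \<psi>_summable])
qed

lemma \<psi>_starshaped:
  assumes "0 \<le> x" "x \<le> y"
  shows "y * \<psi> x \<le> x * \<psi> y"
proof (cases "y = 0")
  case False
  then have y: "0 < y" using assms by simp
  have "y * (y * \<psi> x) \<le> x * (x * \<psi> y)"
    using \<psi>_quadratic[OF assms] by (simp add: power2_eq_square mult.assoc)
  also have "\<dots> \<le> y * (x * \<psi> y)"
    using assms \<psi>_nonneg[of y] by (intro mult_right_mono mult_nonneg_nonneg) auto
  finally show ?thesis using y by simp
qed (use assms in auto)

lemma slope_nonneg: "0 \<le> N \<Longrightarrow> 0 \<le> slope N"
  unfolding slope_def using b_pos
  by (intro suminf_nonneg slope_summable) (auto intro!: mult_nonneg_nonneg intro: less_imp_le)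

lemma \<phi>_tangent:
  assumes "0 \<le> N" "N \<le> r"
  shows "\<phi> N + slope N * (r - N) \<le> \<phi> r"
proof -
  have "\<phi> N + slope N * (r - N)
    = (\<Sum>k. b k * N ^ Suc k + b k * (real (Suc k) * N ^ k) * (r - N))"
    unfolding \<phi>_def slope_def
    by (subst suminf_mult2[OF slope_summable], subst suminf_add)
      (intro \<phi>_summable summable_mult2 slope_summable refl)+
  also have "\<dots> \<le> \<phi> r"
    unfolding \<phi>_def
  proof (intro suminf_le summable_add \<phi>_summable summable_mult2 slope_summable)
    fix k
    have "b k * (N ^ Suc k + real (Suc k) * N ^ k * (r - N)) \<le> b k * r ^ Suc k"
      using b_pos[of k] assms by (intro mult_left_mono power_tangent_le) auto
    then show "b k * N ^ Suc k + b k * (real (Suc k) * N ^ k) * (r - N) \<le> b k * r ^ Suc k"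
      by (simp add: algebra_simps)
  qed
  finally show ?thesis .
qed

lemma \<phi>_le_slope:
  assumes "0 \<le> N"
  shows "\<phi> N \<le> slope N * N"
  unfolding \<phi>_def slope_def suminf_mult2[OF slope_summable]
proof (intro suminf_le \<phi>_summable summable_mult2 slope_summable)
  fix k
  have "b k * (1 * N ^ Suc k) \<le> b k * (real (Suc k) * N ^ Suc k)"
    using b_pos[of k] assms by (intro mult_left_mono mult_right_mono) auto
  then show "b k * N ^ Suc k \<le> b k * (real (Suc k) * N ^ k) * N" by (simp add: algebra_simps)
qed

text \<open>Differentiating and multiplying by \<open>N\<close> scales the term of degree
  \<open>k + 2\<close> by \<open>k + 2\<close>, which is at least 2. This supplies the hypothesis
  \<open>2 * f N \<le> s * N\<close> of \<open>linear_extension_two_thirds\<close>.\<close>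

lemma \<psi>_le_slope:
  assumes "0 \<le> N"
  shows "2 * \<psi> N \<le> (slope N - b 0) * N"
proof -
  have "slope N * N = (\<Sum>k. b k * (real (Suc k) * N ^ k) * N)"
    unfolding slope_def by (rule suminf_mult2[OF slope_summable])
  also have "\<dots> = b 0 * N + (\<Sum>k. b (Suc k) * (real (Suc (Suc k)) * N ^ Suc k) * N)"
    using suminf_split_head[OF summable_mult2[OF slope_summable[of N], of N]] by simp
  finally have eq: "(slope N - b 0) * N = (\<Sum>k. b (Suc k) * (real (Suc (Suc k)) * N ^ Suc k) * N)"
    by (simp add: algebra_simps)
  have "(\<Sum>k. 2 * (b (Suc k) * N ^ Suc (Suc k)))
    \<le> (\<Sum>k. b (Suc k) * (real (Suc (Suc k)) * N ^ Suc k) * N)"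
  proof (intro suminf_le summable_mult \<psi>_summable)
    show "summable (\<lambda>k. b (Suc k) * (real (Suc (Suc k)) * N ^ Suc k) * N)"
      using summable_mult2[OF slope_summable[of N], of N]
      by (subst summable_Suc_iff[of "\<lambda>k. b k * (real (Suc k) * N ^ k) * N"])
    fix k
    have "b (Suc k) * (2 * N ^ Suc (Suc k)) \<le> b (Suc k) * (real (Suc (Suc k)) * N ^ Suc (Suc k))"
      using b_pos[of "Suc k"] assms by (intro mult_left_mono mult_right_mono) auto
    then show "2 * (b (Suc k) * N ^ Suc (Suc k)) \<le> b (Suc k) * (real (Suc (Suc k)) * N ^ Suc k) * N"
      by (simp add: algebra_simps)
  qed
  then show ?thesis unfolding \<psi>_def eq by (simp only: suminf_mult[OF \<psi>_summable])
qed

text \<open>After the pure powers cancel, the mixed binomial terms of each degree are compared one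
  by one with those of the Cauchy product by \<open>b_submult\<close>. This bound turns the gain
  term into a product of weighted moments.\<close>

lemma \<phi>_defect_le:
  assumes "0 \<le> x" "0 \<le> y"
  shows "\<phi> (x + y) - \<phi> x - \<phi> y \<le> \<phi> x * \<phi> y"
proof -
  let ?d = "\<lambda>k. b k * (x + y) ^ Suc k - b k * x ^ Suc k - b k * y ^ Suc k"
  let ?c = "\<lambda>n. \<Sum>i\<le>n. (b i * x ^ Suc i) * (b (n - i) * y ^ Suc (n - i))"
  have ds: "summable ?d" by (intro summable_diff \<phi>_summable)
  have "\<phi> (x + y) - \<phi> x - \<phi> y = (\<Sum>k. ?d k)"
    unfolding \<phi>_def by (simp add: suminf_diff \<phi>_summable summable_diff del: power_Suc)
  \<comment> \<open>The degree-one term has no defect, so the sum starts at degree two, like the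
    Cauchy product.\<close>
  also have "\<dots> = (\<Sum>n. ?d (Suc n))"
    using suminf_split_head[OF ds] by (simp add: algebra_simps)
  also have "\<dots> \<le> (\<Sum>n. ?c n)"
  proof (intro suminf_le)
    show "summable (\<lambda>n. ?d (Suc n))" using ds by (subst summable_Suc_iff)
    have abs: "summable (\<lambda>k. norm (b k * r ^ Suc k))" if "0 \<le> r" for r
      using \<phi>_summable[of r] b_pos that by (simp add: abs_mult less_imp_le)
    show "summable ?c" by (intro summable_Cauchy_product abs assms)
    fix n
    have "(x + y) ^ Suc (Suc n) = (\<Sum>k\<le>Suc (Suc n). real (Suc (Suc n) choose k) * x ^ k * y ^ (Suc (Suc n) - k))"
      by (subst binomial_ring) simp
    also have "\<dots> = y ^ Suc (Suc n) + x ^ Suc (Suc n)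
      + (\<Sum>i\<le>n. real (Suc (Suc n) choose Suc i) * x ^ Suc i * y ^ (Suc n - i))"
      by (subst sum.atMost_Suc, subst sum.atMost_Suc_shift) simp
    finally have e: "?d (Suc n) = (\<Sum>i\<le>n. b (Suc n) * (real (Suc (Suc n) choose Suc i) * x ^ Suc i * y ^ (Suc n - i)))"
      by (simp add: algebra_simps sum_distrib_left del: power_Suc binomial_Suc_Suc)
    also have "\<dots> \<le> ?c n"
    proof (intro sum_mono)
      fix i assume i: "i \<in> {..n}"
      have "real (Suc (Suc n) choose Suc i) * b (Suc n) \<le> b i * b (n - i)"
        using b_submult[of i "n - i"] i by simp
      then have "real (Suc (Suc n) choose Suc i) * b (Suc n) * (x ^ Suc i * y ^ Suc (n - i))
        \<le> b i * b (n - i) * (x ^ Suc i * y ^ Suc (n - i))"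
        using assms by (intro mult_right_mono) auto
      then show "b (Suc n) * (real (Suc (Suc n) choose Suc i) * x ^ Suc i * y ^ (Suc n - i))
        \<le> (b i * x ^ Suc i) * (b (n - i) * y ^ Suc (n - i))"
        using i by (simp add: Suc_diff_le algebra_simps del: binomial_Suc_Suc)
    qed
    finally show "?d (Suc n) \<le> ?c n" .
  qed
  also have "\<dots> = \<phi> x * \<phi> y"
    unfolding \<phi>_def using b_pos assms \<phi>_summable
    by (intro Cauchy_product[symmetric]) (simp_all add: abs_mult less_imp_le)
  finally show ?thesis .
qed

section \<open>Tangent extensions of the two series and bounds on their defect\<close>

definition \<phi>N :: "real \<Rightarrow> real \<Rightarrow> real" where "\<phi>N N = linear_extension (slope N) N \<phi>"

definition \<psi>N :: "real \<Rightarrow> real \<Rightarrow> real" where "\<psi>N N = linear_extension (slope N - b 0) N \<psi>"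

lemma \<phi>N_eq: "\<phi>N N r = b 0 * r + \<psi>N N r"
  by (simp add: \<phi>N_def \<psi>N_def linear_extension_def \<phi>_eq algebra_simps)

lemma \<phi>N_starshaped: "0 < N \<Longrightarrow> 0 \<le> x \<Longrightarrow> x \<le> y \<Longrightarrow> y * \<phi>N N x \<le> x * \<phi>N N y"
  unfolding \<phi>N_def by (rule linear_extension_starshaped) (auto intro: \<phi>_starshaped \<phi>_le_slope)

lemma \<psi>N_starshaped: "0 < N \<Longrightarrow> 0 \<le> x \<Longrightarrow> x \<le> y \<Longrightarrow> y * \<psi>N N x \<le> x * \<psi>N N y"
  unfolding \<psi>N_def using \<psi>_le_slope[of N] \<psi>_nonneg[of N]
  by (intro linear_extension_starshaped) (auto intro: \<psi>_starshaped)

lemma \<phi>N_superadditive: "0 < N \<Longrightarrow> 0 \<le> x \<Longrightarrow> 0 \<le> y \<Longrightarrow> \<phi>N N x + \<phi>N N y \<le> \<phi>N N (x + y)"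
  by (rule starshaped_superadditive) (auto intro: \<phi>N_starshaped)

lemma \<phi>N_nonneg: "0 < N \<Longrightarrow> 0 \<le> r \<Longrightarrow> 0 \<le> \<phi>N N r"
  by (auto simp: \<phi>N_def linear_extension_def intro!: add_nonneg_nonneg \<phi>_nonneg mult_nonneg_nonneg slope_nonneg)

lemma \<phi>N_le_\<phi>: "0 < N \<Longrightarrow> 0 \<le> r \<Longrightarrow> \<phi>N N r \<le> \<phi> r"
  by (auto simp: \<phi>N_def linear_extension_def intro!: \<phi>_tangent)

text \<open>The purpose of the affine tail: up to a multiple of \<open>r\<close>, whose integral is
  the fixed third moment, the weight is bounded and can be paired with limits in
  \<open>L1_norm\<close>.\<close>

lemma \<phi>N_bounded:
  assumes "0 < N" "0 \<le> r"
  shows "\<bar>\<phi>N N r - slope N * r\<bar> \<le> slope N * N"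
proof (cases "r \<le> N")
  case True
  have "N * \<phi> r \<le> r * \<phi> N" using \<phi>_starshaped assms True by blast
  also have "\<dots> \<le> N * (slope N * r)"
    using mult_left_mono[OF \<phi>_le_slope, of N r] assms by (simp add: algebra_simps)
  finally have "\<phi> r \<le> slope N * r" using assms by simp
  moreover have "slope N * r \<le> slope N * N" using True slope_nonneg assms by (intro mult_left_mono) auto
  ultimately show ?thesis using True assms \<phi>_nonneg[of r] by (simp add: \<phi>N_def linear_extension_def)
next
  case False
  then show ?thesis using \<phi>_le_slope[of N] \<phi>_nonneg[of N] assms
    by (simp add: \<phi>N_def linear_extension_def algebra_simps)
qed

text \<open>Beyond \<open>N\<close> the extension is affine, so the defect does not change when both arguments
  are cut off at \<open>N\<close>.\<close>

lemma \<phi>N_defect_le: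
  assumes N: "0 < N" and xy: "0 \<le> x" "0 \<le> y"
  shows "\<phi>N N (x + y) - \<phi>N N x - \<phi>N N y \<le> \<phi>N N x * \<phi>N N y"
proof -
  have cut: "\<phi>N N (x + y) - \<phi>N N x = \<phi>N N (min x N + y) - \<phi>N N (min x N)" if "0 \<le> y" for x y
    using that by (cases "x \<le> N") (auto simp: \<phi>N_def linear_extension_def algebra_simps min_def)
  have mono: "\<phi>N N (min x N) \<le> \<phi>N N x" if "0 \<le> x" for x
    using that N slope_nonneg[of N] by (auto simp: \<phi>N_def linear_extension_def min_def)
  let ?x = "min x N" and ?y = "min y N"
  have le: "\<phi>N N ?x = \<phi> ?x" "\<phi>N N ?y = \<phi> ?y" by (auto simp: \<phi>N_def linear_extension_def)
  have nn: "0 \<le> ?x" "0 \<le> ?y" using N xy by auto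
  have "\<phi>N N (x + y) - \<phi>N N x - \<phi>N N y = \<phi>N N (?x + ?y) - \<phi>N N ?x - \<phi>N N ?y"
    using cut[of y x] cut[of "?x" y] xy nn by (simp add: add.commute)
  also have "\<dots> \<le> \<phi> (?x + ?y) - \<phi> ?x - \<phi> ?y"
    unfolding le using \<phi>N_le_\<phi>[OF N, of "?x + ?y"] nn by simp
  also have "\<dots> \<le> \<phi>N N ?x * \<phi>N N ?y" unfolding le using \<phi>_defect_le nn by blast
  also have "\<dots> \<le> \<phi>N N x * \<phi>N N y"
    using mono xy N nn by (intro mult_mono \<phi>N_nonneg) auto
  finally show ?thesis .
qed

text \<open>The linear part cancels. Both \<open>r\<close> and \<open>R - r\<close> are at most
  \<open>2 * R / 3\<close>, so starshapedness bounds the two values of \<open>\<psi>N\<close> by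
  shares of its value at \<open>2 * R / 3\<close>, and these shares add up to
  \<open>3 / 2\<close>.\<close>

lemma \<phi>N_defect_ge:
  assumes N: "0 < N" and R: "0 < R" and r: "R / 3 \<le> r" "r \<le> 2 * R / 3"
  shows "min 1 (N / R) * \<psi>N N R / 4 \<le> \<phi>N N R - \<phi>N N r - \<phi>N N (R - r)"
proof -
  have "(2 * R / 3) * (\<psi>N N r + \<psi>N N (R - r)) \<le> r * \<psi>N N (2 * R / 3) + (R - r) * \<psi>N N (2 * R / 3)"
    using \<psi>N_starshaped[OF N, of r "2 * R / 3"] \<psi>N_starshaped[OF N, of "R - r" "2 * R / 3"] r R
    by (simp add: algebra_simps)
  also have "\<dots> = (2 * R / 3) * (3 / 2 * \<psi>N N (2 * R / 3))" by (simp add: algebra_simps)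
  finally have "\<psi>N N r + \<psi>N N (R - r) \<le> 3 / 2 * \<psi>N N (2 * R / 3)" using R by simp
  moreover have "min 1 (N / R) * \<psi>N N R / 4 \<le> \<psi>N N R - 3 / 2 * \<psi>N N (2 * R / 3)"
    unfolding \<psi>N_def using N R \<psi>_nonneg \<psi>_le_slope \<psi>_quadratic
    by (intro linear_extension_two_thirds) auto
  ultimately show ?thesis unfolding \<phi>N_eq by (simp add: algebra_simps)
qed

text \<open>Starshapedness makes \<open>\<psi>N N R / R\<close> at least its value at
  \<open>R0\<close>, which the quadratic coefficient bounds below by \<open>b 1 * R0\<close>. The
  linear part is thus absorbed at a cost that does not depend on \<open>N\<close>.\<close>

lemma \<phi>N_le_\<psi>N:
  assumes R0: "0 < R0" "R0 \<le> N" "R0 \<le> R"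
  shows "\<phi>N N R \<le> (1 + b 0 / (b 1 * R0)) * \<psi>N N R"
proof -
  have "b 1 * R0\<^sup>2 = (\<Sum>k\<in>{0}. b (Suc k) * R0 ^ Suc (Suc k))" by (simp add: power2_eq_square)
  also have "\<dots> \<le> \<psi> R0"
    unfolding \<psi>_def using b_pos R0 by (intro sum_le_suminf \<psi>_summable) (auto intro: less_imp_le)
  also have "\<dots> = \<psi>N N R0" using R0 by (simp add: \<psi>N_def linear_extension_def)
  finally have "R * (b 1 * R0\<^sup>2) \<le> R * \<psi>N N R0" using R0 by (intro mult_left_mono) auto
  also have "\<dots> \<le> R0 * \<psi>N N R" using \<psi>N_starshaped[of N R0 R] R0 by simp
  finally have "R0 * (R * (b 1 * R0)) \<le> R0 * \<psi>N N R" by (simp add: power2_eq_square algebra_simps)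
  then have "R * (b 1 * R0) \<le> \<psi>N N R" using R0 by simp
  then have "b 0 / (b 1 * R0) * (R * (b 1 * R0)) \<le> b 0 / (b 1 * R0) * \<psi>N N R"
    using b_pos[of 0] b_pos[of 1] R0 by (intro mult_left_mono) auto
  then show ?thesis unfolding \<phi>N_eq using b_pos[of 1] R0 by (simp add: algebra_simps)
qed

lemma \<phi>_le_linear:
  assumes "0 < R0" "0 \<le> r" "r \<le> R0"
  shows "\<phi> r \<le> \<phi> R0 / R0 * r"
  using \<phi>_starshaped[of r R0] assms by (simp add: field_simps)

lemma \<phi>_continuous: "continuous_on A \<phi>"
proof -
  have "isCont (\<lambda>r. \<Sum>k. b k * r ^ k) x" for x
    by (rule isCont_powser[of _ "\<bar>x\<bar> + 1"]) (use b_summable in auto)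
  moreover have "\<phi> = (\<lambda>r. r * (\<Sum>k. b k * r ^ k))"
    unfolding \<phi>_def by (subst suminf_mult[OF b_summable, symmetric]) (simp add: algebra_simps)
  ultimately show ?thesis by (auto intro!: continuous_at_imp_continuous_on)
qed

lemma \<phi>N_measurable [measurable]: "\<phi>N N \<in> borel_measurable borel"
proof -
  have [measurable]: "\<phi> \<in> borel_measurable borel"
    by (rule borel_measurable_continuous_onI[OF \<phi>_continuous])
  show ?thesis unfolding \<phi>N_def linear_extension_def[abs_def] by measurable
qed

end

section \<open>Weak form of the collision operator\<close>

text \<open>Polar coordinates for radial functions: the image of Lebesgue measure under the norm
  agrees with the density \<open>4 * pi * r^2\<close> on all half-lines, by the volume of balls, and
  half-lines generate the Borel sets.\<close>

lemma nn_integral_norm_real3: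
  fixes h :: "real \<Rightarrow> ennreal"
  assumes [measurable]: "h \<in> borel_measurable borel"
  shows "(\<integral>\<^sup>+p. h (norm p) \<partial>(lborel :: (real ^ 3) measure))
    = (\<integral>\<^sup>+r. ennreal (4 * pi * r\<^sup>2) * indicator {0..} r * h r \<partial>lborel)"
proof -
  let ?M = "distr (lborel :: (real ^ 3) measure) borel norm"
  let ?w = "\<lambda>r::real. ennreal (4 * pi * r\<^sup>2) * indicator {0..} r"
  let ?N = "density lborel ?w"
  have "?M = ?N"
  proof (rule measure_eqI_generator_eq[of "range atMost" UNIV _ _ "\<lambda>n. {..real n}"])
    show "Int_stable (range (atMost :: real \<Rightarrow> real set))"
      by (auto simp: Int_stable_def)
    show "sets ?M = sigma_sets UNIV (range atMost)" "sets ?N = sigma_sets UNIV (range atMost)"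
      by (simp_all add: borel_eq_atMost)
    show "(\<Union>i. {..real i}) = UNIV" by (auto simp: real_arch_simple)
    have M: "emeasure ?M {..x} = (if x < 0 then 0 else ennreal (4 / 3 * pi * x ^ 3))" for x
    proof -
      have "\<not> norm p \<le> x" if "x < 0" for p :: "real ^ 3"
        using norm_ge_zero[of p] that by linarith
      then have "(norm -` {..x} :: (real ^ 3) set) = (if x < 0 then {} else cball 0 x)"
        by auto
      moreover have "emeasure ?M {..x} = emeasure lborel (norm -` {..x} :: (real ^ 3) set)"
        by (subst emeasure_distr) simp_all
      ultimately show ?thesis by (auto simp: emeasure_cball unit_ball_vol_3)
    qed
    have N: "emeasure ?N {..x} = (if x < 0 then 0 else ennreal (4 / 3 * pi * x ^ 3))" for x
    proof -
      have "emeasure ?N {..x} = (\<integral>\<^sup>+r. ennreal (4 * pi * r\<^sup>2) * indicator {0..x} r \<partial>lborel)"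
        by (subst emeasure_density) (auto intro!: nn_integral_cong split: split_indicator)
      also have "\<dots> = (if x < 0 then 0 else ennreal (4 / 3 * pi * x ^ 3))"
      proof (cases "x < 0")
        case False
        then show ?thesis
          by (subst nn_integral_FTC_Icc[where F = "\<lambda>r. 4 / 3 * pi * r ^ 3"])
            (auto intro!: derivative_eq_intros)
      qed simp
      finally show ?thesis .
    qed
    show "\<And>X. X \<in> range atMost \<Longrightarrow> emeasure ?M X = emeasure ?N X"
      using M N by auto
    show "\<And>i. emeasure ?M {..real i} \<noteq> \<infinity>" unfolding M by auto
  qed auto
  have "(\<integral>\<^sup>+p. h (norm p) \<partial>(lborel :: (real ^ 3) measure)) = (\<integral>\<^sup>+r. h r \<partial>?M)"
    by (subst nn_integral_distr) simp_all
  also have "\<dots> = (\<integral>\<^sup>+r. ?w r * h r \<partial>lborel)"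
    unfolding \<open>?M = ?N\<close> by (subst nn_integral_density) simp_all
  finally show ?thesis .
qed

section \<open>Changes of variables in the plane\<close>

abbreviation lborel2 :: "(real \<times> real) measure" where "lborel2 \<equiv> lborel \<Otimes>\<^sub>M lborel"

text \<open>Tonelli, followed by translation invariance in \<open>r\<close> on each slice with
  \<open>s\<close> fixed.\<close>

lemma distr_lborel2_shear: "distr lborel2 lborel2 (\<lambda>(r, s). (s, r - s)) = lborel2"
proof (rule measure_eqI)
  fix A assume "A \<in> sets (distr lborel2 lborel2 (\<lambda>(r, s). (s, r - s)))"
  then have [measurable]: "A \<in> sets (borel \<Otimes>\<^sub>M borel)" by simp
  have "emeasure (distr lborel2 lborel2 (\<lambda>(r, s). (s, r - s))) A
    = (\<integral>\<^sup>+z. indicator A (case z of (r, s) \<Rightarrow> (s, r - s)) \<partial>lborel2)"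
    by (subst nn_integral_indicator[symmetric], simp, subst nn_integral_distr) simp_all
  also have "\<dots> = (\<integral>\<^sup>+s. \<integral>\<^sup>+r. indicator A (s, r - s) \<partial>lborel \<partial>lborel)"
    by (subst lborel_pair.nn_integral_snd[symmetric]) simp_all
  also have "\<dots> = (\<integral>\<^sup>+s. \<integral>\<^sup>+r. indicator A (s, r) \<partial>lborel \<partial>lborel)"
  proof (rule nn_integral_cong)
    fix s :: real
    show "(\<integral>\<^sup>+r. indicator A (s, r - s) \<partial>lborel) = (\<integral>\<^sup>+r. indicator A (s, r) \<partial>lborel)"
      by (subst nn_integral_real_affine[where c = 1 and t = s]) simp_all
  qed
  also have "\<dots> = emeasure lborel2 A"
    by (subst lborel.nn_integral_fst) simp_all
  finally show "emeasure (distr lborel2 lborel2 (\<lambda>(r, s). (s, r - s))) A = emeasure lborel2 A" .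
qed simp

lemma lborel2_shear:
  fixes h :: "real \<Rightarrow> real \<Rightarrow> real"
  assumes [measurable]: "(\<lambda>(x, y). h x y) \<in> borel_measurable lborel2"
  shows "integrable lborel2 (\<lambda>(r, s). h s (r - s)) \<longleftrightarrow> integrable lborel2 (\<lambda>(x, y). h x y)"
    and "(\<integral>(r, s). h s (r - s) \<partial>lborel2) = (\<integral>(x, y). h x y \<partial>lborel2)"
proof -
  have T: "(\<lambda>(r, s). (s, r - s)) \<in> lborel2 \<rightarrow>\<^sub>M lborel2" by measurable
  have e: "(\<lambda>z. case (case z of (r, s) \<Rightarrow> (s, r - s)) of (x, y) \<Rightarrow> h x y) = (\<lambda>(r, s). h s (r - s))"
    by auto
  show "integrable lborel2 (\<lambda>(r, s). h s (r - s)) \<longleftrightarrow> integrable lborel2 (\<lambda>(x, y). h x y)"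
    by (subst (2) distr_lborel2_shear[symmetric], subst integrable_distr_eq[OF T assms]) (simp only: e)
  show "(\<integral>(r, s). h s (r - s) \<partial>lborel2) = (\<integral>(x, y). h x y \<partial>lborel2)"
    by (subst (2) distr_lborel2_shear[symmetric], subst integral_distr[OF T assms]) (simp only: e)
qed

lemma lborel2_swap:
  fixes h :: "real \<Rightarrow> real \<Rightarrow> real"
  assumes [measurable]: "(\<lambda>(x, y). h x y) \<in> borel_measurable lborel2"
  shows "integrable lborel2 (\<lambda>(x, y). h y x) \<longleftrightarrow> integrable lborel2 (\<lambda>(x, y). h x y)"
    and "(\<integral>(x, y). h y x \<partial>lborel2) = (\<integral>(x, y). h x y \<partial>lborel2)"
  using lborel_pair.integrable_product_swap_iff[of "\<lambda>(x, y). h x y"]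
    lborel_pair.integral_product_swap[OF assms] by (simp_all add: case_prod_beta')

text \<open>For collision terms in which \<open>r\<close> is the sum of the two arguments: the inner
  integral runs over all splittings of \<open>r\<close>.\<close>

lemma integral_along_diagonals:
  fixes h :: "real \<Rightarrow> real \<Rightarrow> real"
  assumes "integrable lborel2 (\<lambda>(x, y). h x y)"
  shows "integrable lborel (\<lambda>r. \<integral>s. h s (r - s) \<partial>lborel)"
    and "(\<integral>r. \<integral>s. h s (r - s) \<partial>lborel \<partial>lborel) = (\<integral>(x, y). h x y \<partial>lborel2)"
proof -
  have m: "(\<lambda>(x, y). h x y) \<in> borel_measurable lborel2" using assms by simp
  have i: "integrable lborel2 (\<lambda>(r, s). h s (r - s))" using assms lborel2_shear(1)[OF m] by simp
  show "integrable lborel (\<lambda>r. \<integral>s. h s (r - s) \<partial>lborel)"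
    using lborel_pair.integrable_fst'[OF i] by simp
  show "(\<integral>r. \<integral>s. h s (r - s) \<partial>lborel \<partial>lborel) = (\<integral>(x, y). h x y \<partial>lborel2)"
    using lborel_pair.integral_fst'[OF i] lborel2_shear(2)[OF m] by simp
qed

text \<open>For collision terms in which \<open>r\<close> is one of the two arguments: the inner
  variable is either the sum of both or the other argument.\<close>

lemma integral_along_rows:
  fixes h :: "real \<Rightarrow> real \<Rightarrow> real"
  assumes "integrable lborel2 (\<lambda>(x, y). h x y)"
  shows "integrable lborel (\<lambda>r. \<integral>s. h r (s - r) \<partial>lborel)"
    and "(\<integral>r. \<integral>s. h r (s - r) \<partial>lborel \<partial>lborel) = (\<integral>(x, y). h x y \<partial>lborel2)"
    and "integrable lborel (\<lambda>r. \<integral>s. h r s \<partial>lborel)"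
    and "(\<integral>r. \<integral>s. h r s \<partial>lborel \<partial>lborel) = (\<integral>(x, y). h x y \<partial>lborel2)"
proof -
  have e: "(\<integral>s. h r (s - r) \<partial>lborel) = (\<integral>s. h r s \<partial>lborel)" for r
    by (subst lborel_integral_real_affine[where c = 1 and t = r]) simp_all
  show "integrable lborel (\<lambda>r. \<integral>s. h r s \<partial>lborel)"
    using lborel_pair.integrable_fst'[OF assms] by simp
  then show "integrable lborel (\<lambda>r. \<integral>s. h r (s - r) \<partial>lborel)" unfolding e .
  show "(\<integral>r. \<integral>s. h r s \<partial>lborel \<partial>lborel) = (\<integral>(x, y). h x y \<partial>lborel2)"
    using lborel_pair.integral_fst'[OF assms] by simp
  then show "(\<integral>r. \<integral>s. h r (s - r) \<partial>lborel \<partial>lborel) = (\<integral>(x, y). h x y \<partial>lborel2)"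
    unfolding e .
qed

lemma lborel2_product:
  fixes u v :: "real \<Rightarrow> real"
  assumes u: "integrable lborel u" and v: "integrable lborel v"
  shows "integrable lborel2 (\<lambda>(x, y). u x * v y)"
    and "(\<integral>(x, y). u x * v y \<partial>lborel2) = (\<integral>x. u x \<partial>lborel) * (\<integral>y. v y \<partial>lborel)"
proof -
  have [measurable]: "u \<in> borel_measurable borel" "v \<in> borel_measurable borel" using u v by auto
  show i: "integrable lborel2 (\<lambda>(x, y). u x * v y)"
    using u v by (intro lborel_pair.Fubini_integrable) (auto simp: abs_mult)
  show "(\<integral>(x, y). u x * v y \<partial>lborel2) = (\<integral>x. u x \<partial>lborel) * (\<integral>y. v y \<partial>lborel)"
    using integral_along_rows(4)[OF i] by simp
qed

text \<open>Extending by zero turns the ranges \<open>{0..r}\<close>, \<open>{r..}\<close> and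
  \<open>{0..}\<close> of the collision integrals into the whole line.\<close>

definition quadrant_kernel :: "real \<Rightarrow> real \<Rightarrow> real" where
  "quadrant_kernel x y = indicator {0..} x * indicator {0..} y * coll_kernel x y"

lemma quadrant_kernel_measurable [measurable]:
  "(\<lambda>(x, y). quadrant_kernel x y) \<in> borel_measurable lborel2"
  unfolding quadrant_kernel_def coll_kernel_def by measurable

lemma quadrant_kernel_commute: "quadrant_kernel x y = quadrant_kernel y x"
  by (simp add: quadrant_kernel_def coll_kernel_def ac_simps)

lemma quadrant_kernel_nonneg: "0 \<le> quadrant_kernel x y"
  by (simp add: quadrant_kernel_def coll_kernel_def)

lemma quadrant_kernel_eq_0: "x < 0 \<or> y < 0 \<Longrightarrow> quadrant_kernel x y = 0"
  by (auto simp: quadrant_kernel_def)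

lemma quadrant_kernel_eq: "0 \<le> x \<Longrightarrow> 0 \<le> y \<Longrightarrow> quadrant_kernel x y = x\<^sup>2 * y\<^sup>2 * (x + y)\<^sup>2"
  by (simp add: quadrant_kernel_def coll_kernel_def)

text \<open>A representative whose sign and support conditions hold everywhere, so that pointwise
  estimates have no exceptional sets. The second moment corresponds to integrability on
  three-dimensional space.\<close>

locale radial_profile =
  fixes F :: "real \<Rightarrow> real"
  assumes F_measurable [measurable]: "F \<in> borel_measurable borel"
    and F_nonneg: "0 \<le> F r"
    and F_negative: "r < 0 \<Longrightarrow> F r = 0"
    and F_moment2: "integrable lborel (\<lambda>r. r\<^sup>2 * F r)"
    and F_moment8: "integrable lborel (\<lambda>r. r ^ 8 * F r)"
begin

lemma F_moment:
  assumes "2 \<le> k" "k \<le> 8"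
  shows "integrable lborel (\<lambda>r. r ^ k * F r)"
proof (rule Bochner_Integration.integrable_bound[OF Bochner_Integration.integrable_add[OF F_moment2 F_moment8]])
  show "AE r in lborel. norm (r ^ k * F r) \<le> norm (r\<^sup>2 * F r + r ^ 8 * F r)"
  proof (rule AE_I2)
    fix r :: real
    show "norm (r ^ k * F r) \<le> norm (r\<^sup>2 * F r + r ^ 8 * F r)"
    proof (cases "r < 0")
      case False
      have "r ^ k \<le> r\<^sup>2 + r ^ 8"
      proof (cases "r \<le> 1")
        case True
        then show ?thesis using False assms power_decreasing[of 2 k r] by (simp add: add_increasing2)
      next
        case False
        then show ?thesis using assms power_increasing[of k 8 r] by (simp add: add_increasing)
      qed
      then have "r ^ k * F r \<le> (r\<^sup>2 + r ^ 8) * F r" using F_nonneg by (rule mult_right_mono)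
      then show ?thesis using False F_nonneg[of r] by (simp add: algebra_simps abs_mult)
    qed (simp add: F_negative)
  qed
qed measurable

text \<open>By \<open>(x + y)^2 \<le> 2 * x^2 + 2 * y^2\<close> the integrand is dominated by
  products of second and fourth moments.\<close>

lemma gain_integrable:
  assumes [measurable]: "(\<lambda>(x, y). w x y) \<in> borel_measurable lborel2"
    and w: "\<And>x y. 0 \<le> x \<Longrightarrow> 0 \<le> y \<Longrightarrow> \<bar>w x y\<bar> \<le> C"
  shows "integrable lborel2 (\<lambda>(x, y). quadrant_kernel x y * (F x * F y) * w x y)"
proof (rule Bochner_Integration.integrable_bound)
  show "integrable lborel2 (\<lambda>(x, y). 2 * C * (x ^ 4 * F x * (y\<^sup>2 * F y)) + 2 * C * (x\<^sup>2 * F x * (y ^ 4 * F y)))"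
    using Bochner_Integration.integrable_add[OF
        integrable_mult_right[OF lborel2_product(1)[OF F_moment[of 4] F_moment2], of "2 * C"]
        integrable_mult_right[OF lborel2_product(1)[OF F_moment2 F_moment[of 4]], of "2 * C"]]
    by (simp add: case_prod_beta')
  show "AE z in lborel2. norm (case z of (x, y) \<Rightarrow> quadrant_kernel x y * (F x * F y) * w x y)
    \<le> norm (case z of (x, y) \<Rightarrow> 2 * C * (x ^ 4 * F x * (y\<^sup>2 * F y)) + 2 * C * (x\<^sup>2 * F x * (y ^ 4 * F y)))"
  proof (rule AE_I2, clarsimp)
    fix x y :: real
    show "\<bar>quadrant_kernel x y * (F x * F y) * w x y\<bar>
      \<le> \<bar>2 * C * (x ^ 4 * F x * (y\<^sup>2 * F y)) + 2 * C * (x\<^sup>2 * F x * (y ^ 4 * F y))\<bar>"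
    proof (cases "x < 0 \<or> y < 0")
      case False
      then have xy: "0 \<le> x" "0 \<le> y" by auto
      have "(x + y)\<^sup>2 \<le> 2 * x\<^sup>2 + 2 * y\<^sup>2"
        using zero_le_power2[of "x - y"] by (simp add: power2_eq_square algebra_simps)
      then have "x\<^sup>2 * y\<^sup>2 * (x + y)\<^sup>2 \<le> x\<^sup>2 * y\<^sup>2 * (2 * x\<^sup>2 + 2 * y\<^sup>2)"
        by (intro mult_left_mono) auto
      then have "quadrant_kernel x y * (F x * F y) * \<bar>w x y\<bar>
        \<le> x\<^sup>2 * y\<^sup>2 * (2 * x\<^sup>2 + 2 * y\<^sup>2) * (F x * F y) * C"
        using w[OF xy] xy F_nonneg
        by (intro mult_mono) (auto simp: quadrant_kernel_eq)
      also have "\<dots> = 2 * C * (x ^ 4 * F x * (y\<^sup>2 * F y)) + 2 * C * (x\<^sup>2 * F x * (y ^ 4 * F y))"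
        by (simp add: algebra_simps power2_eq_square power4_eq_xxxx)
      finally show ?thesis using F_nonneg by (simp add: abs_mult quadrant_kernel_nonneg)
    qed (auto simp: quadrant_kernel_eq_0)
  qed
qed measurable

text \<open>With \<open>r = x + y\<close> and \<open>s = x\<close> the kernel is at most
  \<open>s^2 * r^4\<close>. In the linear term, \<open>r^6\<close> integrated over \<open>s\<close>
  from 0 to \<open>r\<close> leads to the seventh moment; the quadratic term separates into a fourth
  and a second moment.\<close>

lemma loss_integrable:
  assumes [measurable]: "(\<lambda>(x, y). w x y) \<in> borel_measurable lborel2"
    and w: "\<And>x y. 0 \<le> x \<Longrightarrow> 0 \<le> y \<Longrightarrow> \<bar>w x y\<bar> \<le> C"
  shows "integrable lborel2 (\<lambda>(x, y). quadrant_kernel x y * F (x + y) * w x y)" (is ?A)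
    and "integrable lborel2 (\<lambda>(x, y). quadrant_kernel x y * (F (x + y) * F x) * w x y)" (is ?B)
proof -
  have C: "0 \<le> C" using w[of 0 0] by simp
  have kernel: "\<bar>quadrant_kernel s (r - s)\<bar> \<le> indicator {0..r} s * (s\<^sup>2 * r ^ 4)"
    "s\<^sup>2 * r ^ 4 \<le> r ^ 6" if "0 \<le> s" "s \<le> r" for r s :: real
  proof -
    have "s\<^sup>2 * (r - s)\<^sup>2 * r\<^sup>2 \<le> s\<^sup>2 * r\<^sup>2 * r\<^sup>2"
      using that by (intro mult_left_mono mult_right_mono power_mono) auto
    then show "\<bar>quadrant_kernel s (r - s)\<bar> \<le> indicator {0..r} s * (s\<^sup>2 * r ^ 4)"
      using that by (simp add: quadrant_kernel_eq power2_eq_square power4_eq_xxxx mult.assoc)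
    have "s\<^sup>2 * r ^ 4 \<le> r\<^sup>2 * r ^ 4" using that by (intro mult_right_mono power_mono) auto
    then show "s\<^sup>2 * r ^ 4 \<le> r ^ 6" by (simp flip: power_add)
  qed
  have [measurable]: "Measurable.pred (borel \<Otimes>\<^sub>M borel) (\<lambda>z :: real \<times> real. snd z \<in> {0..fst z})"
    unfolding atLeastAtMost_iff by measurable
  have "integrable lborel2 (\<lambda>(r, s). quadrant_kernel s (r - s) * F r * w s (r - s))"
  proof (rule Bochner_Integration.integrable_bound)
    show "integrable lborel2 (\<lambda>(r, s). indicator {0..r} s * (C * (r ^ 6 * F r)))"
    proof (rule lborel_pair.Fubini_integrable)
      have *: "(\<integral>s. norm (case (r, s) of (r, s) \<Rightarrow> indicator {0..r} s * (C * (r ^ 6 * F r))) \<partial>lborel)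
        = C * (r ^ 7 * F r)" for r :: real
        using C F_nonneg[of r]
        by (cases "0 \<le> r") (auto simp: abs_mult F_negative power_Suc[symmetric] simp del: power_Suc)
      show "integrable lborel (\<lambda>r. \<integral>s. norm (case (r, s) of (r, s) \<Rightarrow>
          indicator {0..r} s * (C * (r ^ 6 * F r))) \<partial>lborel)"
        unfolding * by (intro integrable_mult_right F_moment) auto
      show "AE r in lborel. integrable lborel
          (\<lambda>s. case (r, s) of (r, s) \<Rightarrow> indicator {0..r} s * (C * (r ^ 6 * F r)))"
        by (intro AE_I2) (auto intro!: integrable_real_indicator simp: emeasure_lborel_Icc_eq)
    qed measurable
    show "AE z in lborel2. norm (case z of (r, s) \<Rightarrow> quadrant_kernel s (r - s) * F r * w s (r - s))
      \<le> norm (case z of (r, s) \<Rightarrow> indicator {0..r} s * (C * (r ^ 6 * F r)))"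
    proof (rule AE_I2, clarify)
      fix r s :: real
      show "norm (quadrant_kernel s (r - s) * F r * w s (r - s)) \<le> norm (indicator {0..r} s * (C * (r ^ 6 * F r)))"
      proof (cases "0 \<le> s \<and> s \<le> r")
        case True
        have "\<bar>quadrant_kernel s (r - s)\<bar> \<le> r ^ 6" using kernel[of s r] True by simp
        then have "\<bar>quadrant_kernel s (r - s)\<bar> * F r * \<bar>w s (r - s)\<bar> \<le> r ^ 6 * F r * C"
          using w[of s "r - s"] True F_nonneg[of r] by (intro mult_mono) auto
        then show ?thesis using True F_nonneg[of r] C by (simp add: abs_mult ac_simps)
      qed (auto simp: quadrant_kernel_eq_0)
    qed
  qed measurable
  then show ?A
    using lborel2_shear(1)[of "\<lambda>x y. quadrant_kernel x y * F (x + y) * w x y"] by simp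
  have "integrable lborel2 (\<lambda>(r, s). quadrant_kernel s (r - s) * (F r * F s) * w s (r - s))"
  proof (rule Bochner_Integration.integrable_bound)
    show "integrable lborel2 (\<lambda>(r, s). C * (r ^ 4 * F r * (s\<^sup>2 * F s)))"
      using integrable_mult_right[OF lborel2_product(1)[OF F_moment[of 4] F_moment2], of C]
      by (simp add: case_prod_beta')
    show "AE z in lborel2. norm (case z of (r, s) \<Rightarrow> quadrant_kernel s (r - s) * (F r * F s) * w s (r - s))
      \<le> norm (case z of (r, s) \<Rightarrow> C * (r ^ 4 * F r * (s\<^sup>2 * F s)))"
    proof (rule AE_I2, clarsimp)
      fix r s :: real
      show "\<bar>quadrant_kernel s (r - s) * (F r * F s) * w s (r - s)\<bar> \<le> \<bar>C * (r ^ 4 * F r * (s\<^sup>2 * F s))\<bar>"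
      proof (cases "0 \<le> s \<and> s \<le> r")
        case True
        then have "\<bar>quadrant_kernel s (r - s)\<bar> * (F r * F s) * \<bar>w s (r - s)\<bar> \<le> s\<^sup>2 * r ^ 4 * (F r * F s) * C"
          using w[of s "r - s"] kernel(1)[of s r] F_nonneg by (intro mult_mono) auto
        then show ?thesis using True F_nonneg C by (simp add: abs_mult ac_simps)
      qed (auto simp: quadrant_kernel_eq_0)
    qed
  qed measurable
  then show ?B
    using lborel2_shear(1)[of "\<lambda>x y. quadrant_kernel x y * (F (x + y) * F x) * w x y"] by simp
qed

lemma coll_measurable [measurable]: "coll F \<in> borel_measurable borel"
proof -
  have [measurable]: "Measurable.pred (borel \<Otimes>\<^sub>M lborel) (\<lambda>z :: real \<times> real. snd z \<in> {0..fst z})"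
    "Measurable.pred (borel \<Otimes>\<^sub>M lborel) (\<lambda>z :: real \<times> real. snd z \<in> {fst z..})"
    unfolding atLeastAtMost_iff atLeast_iff by measurable
  show ?thesis
    unfolding coll_def[abs_def] quad_coll_def lin_coll_def set_lebesgue_integral_def coll_kernel_def
    by measurable
qed

text \<open>The substitutions \<open>x = s, y = r - s\<close> and \<open>x = r, y = s - r\<close> bring all terms of the
  collision operator to the same quadrant.\<close>

lemma coll_weak_form:
  assumes [measurable]: "g \<in> borel_measurable borel" and g: "\<And>r. 0 \<le> r \<Longrightarrow> \<bar>g r\<bar> \<le> C"
  shows "integrable lborel (\<lambda>r. indicator {0..} r * (r\<^sup>2 * coll F r) * g r)" (is ?I)
    and "(\<integral>r. indicator {0..} r * (r\<^sup>2 * coll F r) * g r \<partial>lborel)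
      = (\<integral>(x, y). quadrant_kernel x y * (F x * F y - F (x + y) * (1 + F x + F y))
          * (g (x + y) - g x - g y) \<partial>lborel2)" (is "_ = ?R")
proof -
  let ?q = quadrant_kernel
  \<comment> \<open>One function for each term of the collision operator tested against
    \<open>g\<close>: \<open>h1\<close> to \<open>h5\<close> are quadratic in \<open>F\<close>,
    \<open>h6\<close> and \<open>h7\<close> linear.\<close>
  define h1 where "h1 x y = ?q x y * (F x * F y) * g (x + y)" for x y
  define h2 where "h2 x y = ?q x y * (F (x + y) * F y) * g x" for x y
  define h3 where "h3 x y = ?q x y * (F (x + y) * F x) * g x" for x y
  define h4 where "h4 x y = ?q x y * (F (x + y) * F x) * g (x + y)" for x y
  define h5 where "h5 x y = ?q x y * (F x * F y) * g x" for x y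
  define h6 where "h6 x y = ?q x y * F (x + y) * g x" for x y
  define h7 where "h7 x y = ?q x y * F (x + y) * g (x + y)" for x y
  note h_defs = h1_def h2_def h3_def h4_def h5_def h6_def h7_def
  have int: "integrable lborel2 (\<lambda>(x, y). h1 x y)" "integrable lborel2 (\<lambda>(x, y). h3 x y)"
    "integrable lborel2 (\<lambda>(x, y). h4 x y)" "integrable lborel2 (\<lambda>(x, y). h5 x y)"
    "integrable lborel2 (\<lambda>(x, y). h6 x y)" "integrable lborel2 (\<lambda>(x, y). h7 x y)"
    unfolding h_defs
    by (rule gain_integrable[where C = C] loss_integrable[where C = C], measurable, simp add: g)+
  \<comment> \<open>\<open>loss_integrable\<close> treats the factor \<open>F x\<close>; exchanging
    the variables brings \<open>h2\<close>, which carries \<open>F y\<close>, into that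
    form.\<close>
  have h2_swap: "h2 y x = ?q x y * (F (x + y) * F x) * g y" for x y
    unfolding h2_def by (simp add: quadrant_kernel_commute[of y x] add.commute[of y x])
  have "integrable lborel2 (\<lambda>(x, y). h2 y x)"
    unfolding h2_swap using g by (intro loss_integrable[where C = C]) auto
  moreover have [measurable]: "(\<lambda>(x, y). h2 x y) \<in> borel_measurable lborel2"
    unfolding h_defs by measurable
  ultimately have int2: "integrable lborel2 (\<lambda>(x, y). h2 x y)"
    using lborel2_swap(1)[of h2] by simp
  note int = int int2
  define J where "J r = (\<integral>s. h1 s (r - s) \<partial>lborel) + 2 * (\<integral>s. h2 r (s - r) \<partial>lborel)
    + 2 * (\<integral>s. h3 r (s - r) \<partial>lborel) - 2 * (\<integral>s. h4 s (r - s) \<partial>lborel)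
    - 2 * (\<integral>s. h5 r s \<partial>lborel) + 2 * (\<integral>s. h6 r (s - r) \<partial>lborel) - (\<integral>s. h7 s (r - s) \<partial>lborel)" for r
  have eq: "AE r in lborel. indicator {0..} r * (r\<^sup>2 * coll F r) * g r = J r"
    \<comment> \<open>The origin is removed because the factor \<open>r^2\<close> cancels the
      division in \<open>coll\<close> only away from it.\<close>
    using AE_lborel_singleton[of 0]
  proof eventually_elim
    fix r :: real assume "r \<noteq> 0"
    show "indicator {0..} r * (r\<^sup>2 * coll F r) * g r = J r"
    proof (cases "r < 0")
      case True
      have "h1 s (r - s) = 0" "h4 s (r - s) = 0" "h7 s (r - s) = 0" "h2 r s = 0" "h3 r s = 0"
        "h5 r s = 0" "h6 r s = 0" for s
        using True by (auto simp: h_defs quadrant_kernel_def indicator_def)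
      then show ?thesis using True by (simp add: J_def)
    next
      case False
      have "(\<integral>s. h1 s (r - s) \<partial>lborel) = (LBINT s:{0..r}. coll_kernel s (r - s) * F s * F (r - s)) * g r"
        "(\<integral>s. h4 s (r - s) \<partial>lborel) = F r * (LBINT s:{0..r}. coll_kernel s (r - s) * F s) * g r"
        "(\<integral>s. h7 s (r - s) \<partial>lborel) = F r * (LBINT s:{0..r}. coll_kernel s (r - s)) * g r"
        "(\<integral>s. h2 r (s - r) \<partial>lborel) = (LBINT s:{r..}. coll_kernel r (s - r) * F s * F (s - r)) * g r"
        "(\<integral>s. h3 r (s - r) \<partial>lborel) = F r * (LBINT s:{r..}. coll_kernel r (s - r) * F s) * g r"
        "(\<integral>s. h6 r (s - r) \<partial>lborel) = (LBINT s:{r..}. coll_kernel r (s - r) * F s) * g r"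
        "(\<integral>s. h5 r s \<partial>lborel) = F r * (LBINT s:{0..}. coll_kernel r s * F s) * g r"
        unfolding set_lebesgue_integral_def
          integral_mult_left_zero[symmetric] integral_mult_right_zero[symmetric]
        by (rule Bochner_Integration.integral_cong[OF refl],
            use False in \<open>(auto simp: h_defs quadrant_kernel_def indicator_def)[1]\<close>)+
      then have "J r = (quad_coll F r + lin_coll F r) * g r"
        by (simp add: J_def quad_coll_def lin_coll_def algebra_simps)
      then show ?thesis
        using False \<open>r \<noteq> 0\<close> by (simp add: coll_def)
    qed
  qed
  note i1 = integral_along_diagonals[OF int(1)] and i2 = integral_along_rows[OF int(7)]
    and i3 = integral_along_rows[OF int(2)] and i4 = integral_along_diagonals[OF int(3)]
    and i5 = integral_along_rows[OF int(4)] and i6 = integral_along_rows[OF int(5)]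
    and i7 = integral_along_diagonals[OF int(6)]
  have J: "integrable lborel J"
    unfolding J_def[abs_def]
    using i1 i2 i3 i4 i5 i6 i7 by (intro Bochner_Integration.integrable_add Bochner_Integration.integrable_diff integrable_mult_right)
  have meas: "(\<lambda>r. indicator {0..} r * (r\<^sup>2 * coll F r) * g r) \<in> borel_measurable lborel" by measurable
  show ?I using J integrable_cong_AE[OF meas _ eq] by auto
  have "(\<integral>r. indicator {0..} r * (r\<^sup>2 * coll F r) * g r \<partial>lborel) = (\<integral>r. J r \<partial>lborel)"
    using J by (intro integral_cong_AE meas eq) auto
  also have "\<dots> = (\<integral>(x, y). h1 x y \<partial>lborel2) + 2 * (\<integral>(x, y). h2 x y \<partial>lborel2)
    + 2 * (\<integral>(x, y). h3 x y \<partial>lborel2) - 2 * (\<integral>(x, y). h4 x y \<partial>lborel2)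
    - 2 * (\<integral>(x, y). h5 x y \<partial>lborel2) + 2 * (\<integral>(x, y). h6 x y \<partial>lborel2) - (\<integral>(x, y). h7 x y \<partial>lborel2)"
    unfolding J_def using i1 i2 i3 i4 i5 i6 i7 by simp
  also have "\<dots> = ?R"
  proof -
    \<comment> \<open>Every term with coefficient 2 is replaced by its symmetrisation. Only then
      does the total have the common factor \<open>g (x + y) - g x - g y\<close>.\<close>
    have sym: "2 * (\<integral>(x, y). h x y \<partial>lborel2) = (\<integral>(x, y). h x y + h y x \<partial>lborel2)"
      "integrable lborel2 (\<lambda>(x, y). h x y + h y x)"
      if "integrable lborel2 (\<lambda>(x, y). h x y)" for h :: "real \<Rightarrow> real \<Rightarrow> real"
    proof -
      have m: "(\<lambda>(x, y). h x y) \<in> borel_measurable lborel2" using that by simp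
      have "integrable lborel2 (\<lambda>(x, y). h y x)" using lborel2_swap(1)[OF m] that by simp
      then show "2 * (\<integral>(x, y). h x y \<partial>lborel2) = (\<integral>(x, y). h x y + h y x \<partial>lborel2)"
        "integrable lborel2 (\<lambda>(x, y). h x y + h y x)"
        using that lborel2_swap(2)[OF m] by (simp_all add: case_prod_beta')
    qed
    note s = sym[OF int(7)] sym[OF int(2)] sym[OF int(3)] sym[OF int(4)] sym[OF int(5)]
    have "(\<integral>(x, y). h1 x y \<partial>lborel2) + 2 * (\<integral>(x, y). h2 x y \<partial>lborel2)
      + 2 * (\<integral>(x, y). h3 x y \<partial>lborel2) - 2 * (\<integral>(x, y). h4 x y \<partial>lborel2)
      - 2 * (\<integral>(x, y). h5 x y \<partial>lborel2) + 2 * (\<integral>(x, y). h6 x y \<partial>lborel2) - (\<integral>(x, y). h7 x y \<partial>lborel2)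
      = (\<integral>z. (case z of (x, y) \<Rightarrow> h1 x y) + (case z of (x, y) \<Rightarrow> h2 x y + h2 y x)
        + (case z of (x, y) \<Rightarrow> h3 x y + h3 y x) - (case z of (x, y) \<Rightarrow> h4 x y + h4 y x)
        - (case z of (x, y) \<Rightarrow> h5 x y + h5 y x) + (case z of (x, y) \<Rightarrow> h6 x y + h6 y x)
        - (case z of (x, y) \<Rightarrow> h7 x y) \<partial>lborel2)"
      unfolding s(1) s(3) s(5) s(7) s(9) using s int by simp
    also have "\<dots> = ?R"
    proof (rule Bochner_Integration.integral_cong[OF refl], clarify)
      fix x y
      have "?q y x = ?q x y" "F (y + x) = F (x + y)" "g (y + x) = g (x + y)"
        by (simp_all add: quadrant_kernel_commute[of y x] add.commute[of y x])
      then show "h1 x y + (h2 x y + h2 y x) + (h3 x y + h3 y x) - (h4 x y + h4 y x)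
        - (h5 x y + h5 y x) + (h6 x y + h6 y x) - h7 x y
        = ?q x y * (F x * F y - F (x + y) * (1 + F x + F y)) * (g (x + y) - g x - g y)"
        unfolding h_defs by (simp only:) (simp add: algebra_simps)
    qed
    finally show ?thesis .
  qed
  finally show "(\<integral>r. indicator {0..} r * (r\<^sup>2 * coll F r) * g r \<partial>lborel) = ?R" .
qed

end

section \<open>Gain against loss\<close>

locale weighted_profile = series_weight b + radial_profile F for b F
begin

text \<open>The weight grows at most linearly and so costs one extra moment, whence the bound 7 on
  \<open>k\<close>.\<close>

lemma \<phi>N_moment:
  assumes "0 < N" "2 \<le> k" "k \<le> 7"
  shows "integrable lborel (\<lambda>r. r ^ k * F r * \<phi>N N r)"
proof (rule Bochner_Integration.integrable_bound)
  show "integrable lborel (\<lambda>r. slope N * N * (r ^ k * F r) + slope N * (r ^ Suc k * F r))"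
    using assms by (intro Bochner_Integration.integrable_add integrable_mult_right F_moment) auto
  show "AE r in lborel. norm (r ^ k * F r * \<phi>N N r)
    \<le> norm (slope N * N * (r ^ k * F r) + slope N * (r ^ Suc k * F r))"
  proof (rule AE_I2)
    fix r :: real
    show "norm (r ^ k * F r * \<phi>N N r)
      \<le> norm (slope N * N * (r ^ k * F r) + slope N * (r ^ Suc k * F r))"
    proof (cases "r < 0")
      case False
      then have "\<phi>N N r \<le> slope N * N + slope N * r" using \<phi>N_bounded[of N r] assms by simp
      then have "r ^ k * F r * \<phi>N N r \<le> r ^ k * F r * (slope N * N + slope N * r)"
        using False F_nonneg by (intro mult_left_mono) auto
      also have "\<dots> = slope N * N * (r ^ k * F r) + slope N * (r ^ Suc k * F r)"
        by (simp add: algebra_simps)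
      finally show ?thesis using False F_nonneg[of r] \<phi>N_nonneg[of N r] assms by simp
    qed (simp add: F_negative)
  qed
qed measurable

definition defect :: "real \<Rightarrow> real \<Rightarrow> real \<Rightarrow> real" where
  "defect N x y = \<phi>N N (x + y) - \<phi>N N x - \<phi>N N y"

lemma defect_measurable [measurable]: "(\<lambda>(x, y). defect N x y) \<in> borel_measurable lborel2"
  unfolding defect_def by measurable

lemma defect_commute: "defect N x y = defect N y x"
  by (simp add: defect_def add.commute)

lemma defect_nonneg: "0 < N \<Longrightarrow> 0 \<le> x \<Longrightarrow> 0 \<le> y \<Longrightarrow> 0 \<le> defect N x y"
  using \<phi>N_superadditive[of N x y] by (simp add: defect_def)

lemma defect_bounded:
  assumes "0 < N" "0 \<le> x" "0 \<le> y"
  shows "\<bar>defect N x y\<bar> \<le> 3 * (slope N * N)"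
  using \<phi>N_bounded[of N x] \<phi>N_bounded[of N y] \<phi>N_bounded[of N "x + y"] assms
  by (simp add: defect_def algebra_simps)

text \<open>Combines \<open>\<phi>N_defect_le\<close> with
  \<open>(x + y)^2 \<le> 2 * x^2 + 2 * y^2\<close>; the two resulting products have equal integrals,
  which gives the constant 4.\<close>

lemma gain_le:
  assumes N: "0 < N"
  shows "(\<integral>(x, y). quadrant_kernel x y * (F x * F y) * defect N x y \<partial>lborel2)
    \<le> 4 * (\<integral>r. r\<^sup>2 * F r * \<phi>N N r \<partial>lborel) * (\<integral>r. r ^ 4 * F r * \<phi>N N r \<partial>lborel)"
proof -
  let ?u = "\<lambda>r. r\<^sup>2 * F r * \<phi>N N r" and ?v = "\<lambda>r. r ^ 4 * F r * \<phi>N N r"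
  have u: "integrable lborel ?u" and v: "integrable lborel ?v" using \<phi>N_moment N by auto
  note uv = lborel2_product[OF u v] and vu = lborel2_product[OF v u]
  have "(\<integral>(x, y). quadrant_kernel x y * (F x * F y) * defect N x y \<partial>lborel2)
    \<le> (\<integral>z. 2 * (case z of (x, y) \<Rightarrow> ?u x * ?v y) + 2 * (case z of (x, y) \<Rightarrow> ?v x * ?u y) \<partial>lborel2)"
  proof (rule integral_mono)
    show "integrable lborel2 (\<lambda>(x, y). quadrant_kernel x y * (F x * F y) * defect N x y)"
      using defect_bounded N by (intro gain_integrable) auto
    show "integrable lborel2 (\<lambda>z. 2 * (case z of (x, y) \<Rightarrow> ?u x * ?v y) + 2 * (case z of (x, y) \<Rightarrow> ?v x * ?u y))"
      using uv vu by (intro Bochner_Integration.integrable_add integrable_mult_right) auto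
    fix z :: "real \<times> real"
    obtain x y where z: "z = (x, y)" by (cases z)
    show "(case z of (x, y) \<Rightarrow> quadrant_kernel x y * (F x * F y) * defect N x y)
      \<le> 2 * (case z of (x, y) \<Rightarrow> ?u x * ?v y) + 2 * (case z of (x, y) \<Rightarrow> ?v x * ?u y)"
    proof (cases "x < 0 \<or> y < 0")
      case False
      then have xy: "0 \<le> x" "0 \<le> y" by auto
      have "(x + y)\<^sup>2 \<le> 2 * x\<^sup>2 + 2 * y\<^sup>2"
        using zero_le_power2[of "x - y"] by (simp add: power2_eq_square algebra_simps)
      then have "x\<^sup>2 * y\<^sup>2 * (x + y)\<^sup>2 \<le> x\<^sup>2 * y\<^sup>2 * (2 * x\<^sup>2 + 2 * y\<^sup>2)"
        by (intro mult_left_mono) auto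
      then have "quadrant_kernel x y * (F x * F y) * defect N x y
        \<le> x\<^sup>2 * y\<^sup>2 * (2 * x\<^sup>2 + 2 * y\<^sup>2) * (F x * F y) * (\<phi>N N x * \<phi>N N y)"
        using xy F_nonneg \<phi>N_defect_le[OF N xy] defect_nonneg[OF N xy]
        by (intro mult_mono) (auto simp: quadrant_kernel_eq defect_def)
      also have "\<dots> = 2 * (?u x * ?v y) + 2 * (?v x * ?u y)"
        by (simp add: algebra_simps power2_eq_square power4_eq_xxxx)
      finally show ?thesis by (simp add: z)
    qed (auto simp: z quadrant_kernel_eq_0 F_negative)
  qed
  also have "\<dots> = 4 * (\<integral>r. ?u r \<partial>lborel) * (\<integral>r. ?v r \<partial>lborel)"
    using uv vu by simp
  finally show ?thesis .
qed

text \<open>Only the splittings into two parts of size between one and two thirds of the whole are used.\<close>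

lemma loss_ge:
  assumes R0: "0 < R0" "R0 \<le> N"
  shows "R0 ^ 3 / (243 * (1 + b 0 / (b 1 * R0)))
      * (\<integral>r. indicator {R0..} r * (r ^ 4 * F r * \<phi>N N r) \<partial>lborel)
    \<le> (\<integral>(x, y). quadrant_kernel x y * F (x + y) * defect N x y \<partial>lborel2)"
proof -
  have N: "0 < N" using R0 by simp
  \<comment> \<open>The constant is \<open>243 = 3 * 81\<close>: the kernel contributes
    \<open>4 / 81\<close>, the defect \<open>1 / 4\<close>, and the window of splittings has length
    \<open>r / 3\<close>.\<close>
  define A where "A = R0 ^ 3 / (243 * (1 + b 0 / (b 1 * R0)))"
  have pos: "0 < 1 + b 0 / (b 1 * R0)" using b_pos[of 0] b_pos[of 1] R0 by (simp add: add_pos_pos)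
  have A: "0 \<le> A" using R0 pos by (simp add: A_def)
  let ?l = "\<lambda>r s. quadrant_kernel s (r - s) * F r * defect N s (r - s)"
  \<comment> \<open>The factor 3 offsets the length \<open>r / 3\<close> of the window, so that
    integrating over \<open>s\<close> leaves exactly \<open>A\<close> times the integrand in
    \<open>r\<close>.\<close>
  let ?k = "\<lambda>r s. indicator {R0..} r * (indicator {r / 3..2 * r / 3} s * (3 * A * (r ^ 3 * F r * \<phi>N N r)))"
  have l_nonneg: "0 \<le> ?l r s" for r s
    using quadrant_kernel_nonneg[of s "r - s"] F_nonneg[of r] defect_nonneg[OF N, of s "r - s"]
    by (cases "s < 0 \<or> r - s < 0") (auto simp: quadrant_kernel_eq_0)
  have kl: "?k r s \<le> ?l r s" for r s
  proof (cases "R0 \<le> r \<and> r / 3 \<le> s \<and> s \<le> 2 * r / 3")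
    case True
    then have r: "0 < r" "R0 \<le> r" and s: "0 \<le> s" "s \<le> r" using R0 by auto
    \<comment> \<open>On the window the product \<open>s * (r - s)\<close> is smallest at the two
      ends, where it equals \<open>2 / 9 * r^2\<close>.\<close>
    have "0 \<le> (s - r / 3) * (2 * r / 3 - s)" using True by (intro mult_nonneg_nonneg) auto
    also have "\<dots> = s * (r - s) - 2 / 9 * r\<^sup>2" by (simp add: field_simps power2_eq_square)
    finally have "2 / 9 * r\<^sup>2 \<le> s * (r - s)" by simp
    then have "(2 / 9 * r\<^sup>2)\<^sup>2 * r\<^sup>2 \<le> (s * (r - s))\<^sup>2 * r\<^sup>2"
      by (intro mult_right_mono power_mono) auto
    then have q: "4 / 81 * r ^ 6 \<le> quadrant_kernel s (r - s)"
      using s by (simp add: quadrant_kernel_eq power_mult_distrib power2_eq_square power4_eq_xxxx eval_nat_numeral algebra_simps)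
    \<comment> \<open>Replacing \<open>N\<close> by \<open>R0\<close> here makes the loss bound
      uniform in \<open>N\<close>.\<close>
    have "R0 / r \<le> min 1 (N / r)" using r R0 by (auto simp: field_simps)
    moreover have psi: "0 \<le> \<psi>N N r"
    proof -
      have "r * \<psi>N N R0 \<le> R0 * \<psi>N N r" using \<psi>N_starshaped[OF N, of R0 r] R0 r by simp
      moreover have "0 \<le> r * \<psi>N N R0"
        using \<psi>_nonneg[of R0] R0 r by (simp add: \<psi>N_def linear_extension_def)
      ultimately show ?thesis using R0 by (smt (verit) zero_le_mult_iff)
    qed
    ultimately have "R0 / r * \<psi>N N r / 4 \<le> min 1 (N / r) * \<psi>N N r / 4"
      by (intro divide_right_mono mult_right_mono) auto
    also have "\<dots> \<le> defect N s (r - s)"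
      using \<phi>N_defect_ge[OF N, of r s] r True by (simp add: defect_def)
    finally have d: "R0 / r * \<psi>N N r / 4 \<le> defect N s (r - s)" .
    have "3 * A * \<phi>N N r \<le> 3 * A * ((1 + b 0 / (b 1 * R0)) * \<psi>N N r)"
      using A \<phi>N_le_\<psi>N[of R0 N r] R0 r by (intro mult_left_mono) auto
    also have "\<dots> = R0 ^ 3 / 81 * \<psi>N N r"
    proof -
      have "3 * (R0 ^ 3 / (243 * D)) * (D * p) = R0 ^ 3 / 81 * p" if "0 < D" for D p :: real
        using that by (simp add: field_simps)
      from this[OF pos] show ?thesis unfolding A_def .
    qed
    \<comment> \<open>Two of the three powers of \<open>R0\<close> are traded for powers of
      \<open>r\<close>; the third one is the factor \<open>R0 / r\<close> of the defect
      bound.\<close>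
    also have "\<dots> = R0 * R0\<^sup>2 / 81 * \<psi>N N r" by (simp add: power2_eq_square power3_eq_cube)
    also have "\<dots> \<le> R0 * r\<^sup>2 / 81 * \<psi>N N r"
      using R0 r psi by (intro mult_right_mono divide_right_mono mult_left_mono power_mono) auto
    finally have "r ^ 3 * (3 * A * \<phi>N N r) \<le> r ^ 3 * (R0 * r\<^sup>2 / 81 * \<psi>N N r)"
      using r by (intro mult_left_mono) auto
    also have "\<dots> = 4 / 81 * r ^ 6 * (R0 / r * \<psi>N N r / 4)"
      using r by (simp add: field_simps eval_nat_numeral)
    also have "\<dots> \<le> quadrant_kernel s (r - s) * defect N s (r - s)"
      using q d r R0 psi by (intro mult_mono) (auto intro: quadrant_kernel_nonneg)
    finally have "r ^ 3 * (3 * A * \<phi>N N r) * F r \<le> quadrant_kernel s (r - s) * defect N s (r - s) * F r"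
      using F_nonneg by (intro mult_right_mono)
    then show ?thesis using True by (simp add: ac_simps)
  next
    case False
    then have "?k r s = 0" by (auto simp: indicator_def)
    then show ?thesis using l_nonneg by (rule ord_eq_le_trans)
  qed
  have m: "(\<lambda>(x, y). quadrant_kernel x y * F (x + y) * defect N x y) \<in> borel_measurable lborel2"
    by measurable
  have "integrable lborel2 (\<lambda>(x, y). quadrant_kernel x y * F (x + y) * defect N x y)"
    using defect_bounded N by (intro loss_integrable(1)) auto
  then have l_int: "integrable lborel2 (\<lambda>(r, s). ?l r s)" using lborel2_shear(1)[OF m] by simp
  have [measurable]: "Measurable.pred (borel \<Otimes>\<^sub>M borel) (\<lambda>z :: real \<times> real. snd z \<in> {fst z / 3..2 * fst z / 3})"
    unfolding atLeastAtMost_iff by measurable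
  have k_int: "integrable lborel2 (\<lambda>(r, s). ?k r s)"
  proof (rule Bochner_Integration.integrable_bound[OF l_int])
    show "AE z in lborel2. norm (case z of (r, s) \<Rightarrow> ?k r s) \<le> norm (case z of (r, s) \<Rightarrow> ?l r s)"
    proof (rule AE_I2, clarify)
      fix r s :: real
      have "0 \<le> ?k r s" using A F_nonneg[of r] \<phi>N_nonneg[OF N, of r] R0 by (auto simp: indicator_def)
      then have "norm (?k r s) = ?k r s" by (simp only: real_norm_def abs_of_nonneg)
      also have "\<dots> \<le> ?l r s" by (rule kl)
      also have "\<dots> \<le> norm (?l r s)" by (simp only: real_norm_def abs_ge_self)
      finally show "norm (?k r s) \<le> norm (?l r s)" .
    qed
  qed measurable
  have inner: "(\<integral>s. ?k r s \<partial>lborel) = A * (indicator {R0..} r * (r ^ 4 * F r * \<phi>N N r))" for r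
    using R0 by (auto simp: indicator_def[of "{R0..}"] eval_nat_numeral)
  have "A * (\<integral>r. indicator {R0..} r * (r ^ 4 * F r * \<phi>N N r) \<partial>lborel)
    = (\<integral>r. A * (indicator {R0..} r * (r ^ 4 * F r * \<phi>N N r)) \<partial>lborel)"
    by (rule integral_mult_right_zero[symmetric])
  also have "\<dots> = (\<integral>r. \<integral>s. ?k r s \<partial>lborel \<partial>lborel)" by (simp only: inner)
  also have "\<dots> = (\<integral>(r, s). ?k r s \<partial>lborel2)"
    using lborel_pair.integral_fst'[OF k_int] by simp
  also have "\<dots> \<le> (\<integral>(r, s). ?l r s \<partial>lborel2)"
    using kl by (intro integral_mono k_int l_int) auto
  also have "\<dots> = (\<integral>(x, y). quadrant_kernel x y * F (x + y) * defect N x y \<partial>lborel2)"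
    using lborel2_shear(2)[OF m] by simp
  finally show ?thesis by (simp add: A_def)
qed

text \<open>Both quadratic losses have a sign, because the defect is nonnegative, and are dropped;
  what remains is the gain minus the linear loss.\<close>

lemma coll_\<phi>N_le:
  assumes N: "0 < N"
  shows "(\<integral>r. indicator {0..} r * (r\<^sup>2 * coll F r) * (\<phi>N N r - slope N * r) \<partial>lborel)
    \<le> (\<integral>(x, y). quadrant_kernel x y * (F x * F y) * defect N x y \<partial>lborel2)
      - (\<integral>(x, y). quadrant_kernel x y * F (x + y) * defect N x y \<partial>lborel2)"
proof -
  have gain: "integrable lborel2 (\<lambda>(x, y). quadrant_kernel x y * (F x * F y) * defect N x y)"
    using defect_bounded N by (intro gain_integrable) auto
  have loss: "integrable lborel2 (\<lambda>(x, y). quadrant_kernel x y * F (x + y) * defect N x y)"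
    "integrable lborel2 (\<lambda>(x, y). quadrant_kernel x y * (F (x + y) * F x) * defect N x y)"
    using defect_bounded N by (intro loss_integrable; auto)+
  have "integrable lborel2 (\<lambda>(x, y). quadrant_kernel y x * (F (y + x) * F y) * defect N y x)"
    using loss(2) by (subst lborel2_swap(1)) auto
  then have loss': "integrable lborel2 (\<lambda>(x, y). quadrant_kernel x y * (F (x + y) * F y) * defect N x y)"
    by (subst quadrant_kernel_commute, subst defect_commute, subst add.commute)
  have eq: "(\<lambda>(x, y). quadrant_kernel x y * (F x * F y - F (x + y) * (1 + F x + F y)) * defect N x y)
    = (\<lambda>z. (case z of (x, y) \<Rightarrow> quadrant_kernel x y * (F x * F y) * defect N x y)
      - (case z of (x, y) \<Rightarrow> quadrant_kernel x y * F (x + y) * defect N x y)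
      - (case z of (x, y) \<Rightarrow> quadrant_kernel x y * (F (x + y) * F x) * defect N x y)
      - (case z of (x, y) \<Rightarrow> quadrant_kernel x y * (F (x + y) * F y) * defect N x y))"
    by (auto simp: algebra_simps)
  have nonneg: "0 \<le> quadrant_kernel x y * (F (x + y) * c) * defect N x y" if "0 \<le> c" for x y c
    using that quadrant_kernel_nonneg[of x y] F_nonneg[of "x + y"] defect_nonneg[OF N, of x y]
    by (cases "x < 0 \<or> y < 0") (auto simp: quadrant_kernel_eq_0)
  have "(\<integral>r. indicator {0..} r * (r\<^sup>2 * coll F r) * (\<phi>N N r - slope N * r) \<partial>lborel)
    = (\<integral>(x, y). quadrant_kernel x y * (F x * F y - F (x + y) * (1 + F x + F y)) * defect N x y \<partial>lborel2)"
    using \<phi>N_bounded[OF N] by (subst coll_weak_form(2)) (auto simp: defect_def algebra_simps)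
  also have "\<dots> = (\<integral>(x, y). quadrant_kernel x y * (F x * F y) * defect N x y \<partial>lborel2)
      - (\<integral>(x, y). quadrant_kernel x y * F (x + y) * defect N x y \<partial>lborel2)
      - (\<integral>(x, y). quadrant_kernel x y * (F (x + y) * F x) * defect N x y \<partial>lborel2)
      - (\<integral>(x, y). quadrant_kernel x y * (F (x + y) * F y) * defect N x y \<partial>lborel2)"
    unfolding eq
    by (simp only: Bochner_Integration.integral_diff Bochner_Integration.integrable_diff gain loss loss')
  also have "\<dots> \<le> (\<integral>(x, y). quadrant_kernel x y * (F x * F y) * defect N x y \<partial>lborel2)
      - (\<integral>(x, y). quadrant_kernel x y * F (x + y) * defect N x y \<partial>lborel2)"
  proof -
    have "0 \<le> (\<integral>(x, y). quadrant_kernel x y * (F (x + y) * F x) * defect N x y \<partial>lborel2)"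
      "0 \<le> (\<integral>(x, y). quadrant_kernel x y * (F (x + y) * F y) * defect N x y \<partial>lborel2)"
      using nonneg F_nonneg by (auto intro!: Bochner_Integration.integral_nonneg)
    then show ?thesis by simp
  qed
  finally show ?thesis .
qed

text \<open>With \<open>E\<close> the weighted mass, \<open>Y\<close> the weighted fourth moment and
  \<open>X\<close> its part over \<open>{R0..}\<close>, the rate is at most
  \<open>4 * E * Y - A * X\<close>. Splitting at \<open>R0\<close> gives
  \<open>Y \<le> R0^2 * c * h + X\<close> and \<open>X \<ge> R0^2 * (E - c * h)\<close>. Since
  \<open>\<omega> * E\<close> lies between 1 and 2, \<open>small\<close> and \<open>large\<close>
  make the near and far contributions both comparable to \<open>4 * R0^2 / \<omega>^2\<close>, and
  they cancel.\<close>

lemma coll_\<phi>N_nonpos: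
  assumes R0: "0 < R0" "R0 \<le> N" and \<omega>: "0 < \<omega>"
    and small: "\<phi> R0 / R0 * (\<integral>r. r ^ 3 * F r \<partial>lborel) \<le> 1 / (2 * \<omega>)"
    and large: "16 / \<omega> \<le> R0 ^ 3 / (243 * (1 + b 0 / (b 1 * R0)))"
    and e: "1 \<le> \<omega> * (\<integral>r. r\<^sup>2 * F r * \<phi>N N r \<partial>lborel)"
      "\<omega> * (\<integral>r. r\<^sup>2 * F r * \<phi>N N r \<partial>lborel) \<le> 2"
  shows "(\<integral>r. indicator {0..} r * (r\<^sup>2 * coll F r) * (\<phi>N N r - slope N * r) \<partial>lborel) \<le> 0"
proof -
  have N: "0 < N" using R0 by simp
  define A where "A = R0 ^ 3 / (243 * (1 + b 0 / (b 1 * R0)))"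
  define c where "c = \<phi> R0 / R0"
  define h where "h = (\<integral>r. r ^ 3 * F r \<partial>lborel)"
  define E where "E = (\<integral>r. r\<^sup>2 * F r * \<phi>N N r \<partial>lborel)"
  define X where "X = (\<integral>r. indicator {R0..} r * (r ^ 4 * F r * \<phi>N N r) \<partial>lborel)"
  define Y where "Y = (\<integral>r. r ^ 4 * F r * \<phi>N N r \<partial>lborel)"
  have c: "0 \<le> c" using \<phi>_nonneg R0 by (simp add: c_def)
  have i2: "integrable lborel (\<lambda>r. r\<^sup>2 * F r * \<phi>N N r)" and i4: "integrable lborel (\<lambda>r. r ^ 4 * F r * \<phi>N N r)"
    and i3: "integrable lborel (\<lambda>r. r ^ 3 * F r)"
    using \<phi>N_moment F_moment N by auto
  have iX: "integrable lborel (\<lambda>r. indicator {R0..} r * (r ^ 4 * F r * \<phi>N N r))"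
    using integrable_mult_indicator[OF _ i4, of "{R0..}"] by simp
  have near: "\<phi>N N r \<le> c * r" if "0 \<le> r" "r \<le> R0" for r
    using \<phi>N_le_\<phi>[OF N, of r] \<phi>_le_linear[of R0 r] that R0 by (simp add: c_def)
  \<comment> \<open>Below \<open>R0\<close> the weight is at most \<open>c * r\<close>, which leaves
    the third moment; above it, \<open>R0^2 \<le> r^2\<close>.\<close>
  have "R0\<^sup>2 * E \<le> (\<integral>r. R0\<^sup>2 * c * (r ^ 3 * F r) + indicator {R0..} r * (r ^ 4 * F r * \<phi>N N r) \<partial>lborel)"
    unfolding E_def integral_mult_right_zero[symmetric]
  proof (intro integral_mono Bochner_Integration.integrable_add integrable_mult_right i2 i3 iX)
    fix r :: real
    consider "r < 0" | "0 \<le> r" "r < R0" | "R0 \<le> r" by linarith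
    then show "R0\<^sup>2 * (r\<^sup>2 * F r * \<phi>N N r) \<le> R0\<^sup>2 * c * (r ^ 3 * F r) + indicator {R0..} r * (r ^ 4 * F r * \<phi>N N r)"
    proof cases
      case 2
      have "R0\<^sup>2 * (r\<^sup>2 * F r) * \<phi>N N r \<le> R0\<^sup>2 * (r\<^sup>2 * F r) * (c * r)"
        using 2 near F_nonneg by (intro mult_left_mono) auto
      then show ?thesis using 2 by (simp add: power2_eq_square power3_eq_cube algebra_simps)
    next
      case 3
      have "R0\<^sup>2 * (r\<^sup>2 * F r * \<phi>N N r) \<le> r\<^sup>2 * (r\<^sup>2 * F r * \<phi>N N r)"
        using 3 R0 F_nonneg \<phi>N_nonneg[OF N] by (intro mult_right_mono power_mono) auto
      moreover have "0 \<le> R0\<^sup>2 * c * (r ^ 3 * F r)" using c F_nonneg[of r] 3 R0 by simp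
      ultimately show ?thesis using 3 by (simp add: power2_eq_square power4_eq_xxxx algebra_simps)
    qed (simp add: F_negative)
  qed
  also have "\<dots> = R0\<^sup>2 * c * h + X" unfolding h_def X_def using i3 iX by simp
  finally have X: "R0\<^sup>2 * (E - c * h) \<le> X" by (simp add: algebra_simps)
  have "Y \<le> (\<integral>r. R0\<^sup>2 * c * (r ^ 3 * F r) + indicator {R0..} r * (r ^ 4 * F r * \<phi>N N r) \<partial>lborel)"
    unfolding Y_def
  proof (intro integral_mono Bochner_Integration.integrable_add integrable_mult_right i4 i3 iX)
    fix r :: real
    consider "r < 0" | "0 \<le> r" "r < R0" | "R0 \<le> r" by linarith
    then show "r ^ 4 * F r * \<phi>N N r \<le> R0\<^sup>2 * c * (r ^ 3 * F r) + indicator {R0..} r * (r ^ 4 * F r * \<phi>N N r)"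
    proof cases
      case 2
      have "r\<^sup>2 * (r\<^sup>2 * F r * \<phi>N N r) \<le> R0\<^sup>2 * (r\<^sup>2 * F r * (c * r))"
        using 2 near F_nonneg \<phi>N_nonneg[OF N] by (intro mult_mono power_mono mult_left_mono) auto
      then show ?thesis using 2 by (simp add: power2_eq_square power3_eq_cube power4_eq_xxxx algebra_simps)
    next
      case 3
      then show ?thesis using c F_nonneg[of r] R0 by simp
    qed (simp add: F_negative)
  qed
  also have "\<dots> = R0\<^sup>2 * c * h + X" unfolding h_def X_def using i3 iX by simp
  finally have Y: "Y \<le> R0\<^sup>2 * (c * h) + X" by (simp add: algebra_simps)
  have E: "1 / \<omega> \<le> E" "E \<le> 2 / \<omega>" using e \<omega> by (auto simp: E_def field_simps)
  have E0: "0 < E" using E \<omega> by (smt (verit) zero_less_divide_1_iff)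
  have ch: "c * h \<le> 1 / (2 * \<omega>)" using small by (simp add: c_def h_def)
  have "(\<integral>r. indicator {0..} r * (r\<^sup>2 * coll F r) * (\<phi>N N r - slope N * r) \<partial>lborel) \<le> 4 * E * Y - A * X"
    using coll_\<phi>N_le[OF N] gain_le[OF N] loss_ge[OF R0]
    by (simp add: E_def Y_def A_def X_def)
  also have "\<dots> \<le> 4 * E * (R0\<^sup>2 * (c * h) + X) - A * X"
    using mult_left_mono[OF Y, of "4 * E"] E0 by simp
  also have "\<dots> = 4 * E * R0\<^sup>2 * (c * h) - (A - 4 * E) * X" by (simp add: algebra_simps)
  also have "\<dots> \<le> 4 * E * R0\<^sup>2 * (c * h) - 8 / \<omega> * (R0\<^sup>2 * (1 / (2 * \<omega>)))"
  proof -
    \<comment> \<open>Half of \<open>A \<ge> 16 / \<omega>\<close> is spent on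
      \<open>4 * E \<le> 8 / \<omega>\<close>; the other half has to pay for the near part.\<close>
    have AE: "8 / \<omega> \<le> A - 4 * E" using large E by (simp add: A_def)
    moreover have "0 \<le> A - 4 * E" using AE \<omega> by (smt (verit) divide_pos_pos)
    moreover have "R0\<^sup>2 * (1 / (2 * \<omega>)) \<le> X"
    proof -
      have "1 / (2 * \<omega>) \<le> E - c * h" using E ch \<omega> by (simp add: field_simps)
      then have "R0\<^sup>2 * (1 / (2 * \<omega>)) \<le> R0\<^sup>2 * (E - c * h)" by (intro mult_left_mono) auto
      then show ?thesis using X by simp
    qed
    ultimately have "8 / \<omega> * (R0\<^sup>2 * (1 / (2 * \<omega>))) \<le> (A - 4 * E) * X"
      using \<omega> by (intro mult_mono) auto
    then show ?thesis by simp
  qed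
  also have "\<dots> \<le> 4 * (2 / \<omega>) * R0\<^sup>2 * (1 / (2 * \<omega>)) - 8 / \<omega> * (R0\<^sup>2 * (1 / (2 * \<omega>)))"
  proof -
    have h0: "0 \<le> h" unfolding h_def
      by (intro Bochner_Integration.integral_nonneg) (metis F_negative F_nonneg mult_zero_right not_le
          mult_nonneg_nonneg zero_le_power)
    have "4 * E * R0\<^sup>2 * (c * h) \<le> 4 * (2 / \<omega>) * R0\<^sup>2 * (1 / (2 * \<omega>))"
      using E E0 ch c h0 \<omega> by (intro mult_mono) auto
    then show ?thesis by simp
  qed
  also have "\<dots> = 0" by simp
  finally show ?thesis .
qed

end

section \<open>Evolution of the weighted mass\<close>

text \<open>A null set of radii pulls back to a null set of points, by polar coordinates applied to
  its indicator.\<close>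

lemma AE_norm_real3:
  assumes "AE r in lborel. 0 \<le> r \<longrightarrow> Q r"
  shows "AE p in (lborel :: (real ^ 3) measure). Q (norm p)"
proof -
  obtain N where N: "N \<in> null_sets lborel" "{r. \<not> (0 \<le> r \<longrightarrow> Q r)} \<subseteq> N"
    using assms unfolding eventually_ae_filter by auto
  then have [measurable]: "N \<in> sets borel" by auto
  have "AE r in lborel. r \<notin> N" using N by (simp add: AE_not_in)
  then have "(\<integral>\<^sup>+r. ennreal (4 * pi * r\<^sup>2) * indicator {0..} r * indicator N r \<partial>lborel) = 0"
    by (subst nn_integral_0_iff_AE) (auto elim!: eventually_mono)
  then have "(\<integral>\<^sup>+p. indicator N (norm p) \<partial>(lborel :: (real ^ 3) measure)) = 0"
    by (subst nn_integral_norm_real3) simp_all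
  then have "AE p in (lborel :: (real ^ 3) measure). indicator N (norm p) = (0 :: ennreal)"
    by (subst (asm) nn_integral_0_iff_AE) auto
  then show ?thesis
  proof eventually_elim
    case (elim p)
    then have "norm p \<notin> N" by (simp add: indicator_eq_0_iff)
    then have "norm p \<notin> {r. \<not> (0 \<le> r \<longrightarrow> Q r)}" using N(2) by blast
    then show ?case by simp
  qed
qed

text \<open>The representative that satisfies the sign and support conditions of
  \<open>radial_profile\<close> at every point.\<close>

definition positive_profile :: "(real \<Rightarrow> real) \<Rightarrow> real \<Rightarrow> real" where
  "positive_profile f r = indicator {0..} r * max 0 (f r)"

text \<open>Measurability of the radial function passes to its profile by restriction to a
  coordinate ray.\<close>

lemma lift3_measurable_imp:
  assumes "lift3 f \<in> borel_measurable borel"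
  shows "(\<lambda>r. indicator {0..} r * f r) \<in> borel_measurable borel"
proof -
  have "(\<lambda>r. r *\<^sub>R (axis 1 1 :: real ^ 3)) \<in> borel_measurable borel" by simp
  then have [measurable]: "(\<lambda>r. lift3 f (r *\<^sub>R axis 1 1)) \<in> borel_measurable borel"
    using assms by (rule measurable_compose)
  have "(\<lambda>r. indicator {0..} r * f r) = (\<lambda>r. indicator {0..} r * lift3 f (r *\<^sub>R axis 1 1))"
    by (auto simp: lift3_def indicator_def)
  then show ?thesis by simp
qed

text \<open>Replaces a member of the invariant set by an everywhere nonnegative representative, so
  that the estimates for \<open>radial_profile\<close> apply.\<close>

lemma invariant_set_profile:
  assumes f: "f \<in> invariant_set h3 h8 hinf"
  shows "AE r in lborel. 0 \<le> r \<longrightarrow> f r = positive_profile f r"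
    and "radial_profile (positive_profile f)"
    and "(\<integral>r. r ^ 3 * positive_profile f r \<partial>lborel) = h3"
    and "(\<lambda>r. indicator {0..} r * f r) \<in> borel_measurable borel"
proof -
  let ?F = "positive_profile f" and ?f = "\<lambda>r. indicator {0..} r * f r"
  have int: "integrable lborel (lift3 f)" and nonneg: "AE p in lborel. 0 \<le> lift3 f p"
    and h3: "line_moment 3 f = h3" and m8: "finite_moment 8 f"
    using f by (auto simp: invariant_set_def)
  show meas [measurable]: "?f \<in> borel_measurable borel"
    using int by (intro lift3_measurable_imp) auto
  have F_eq: "?F = (\<lambda>r. max 0 (?f r))"
    by (auto simp: positive_profile_def indicator_def)
  have [measurable]: "?F \<in> borel_measurable borel" unfolding F_eq by measurable
  define S where "S = {r. ?f r < 0}"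
  have [measurable]: "S \<in> sets borel" unfolding S_def by measurable
  have "AE p in (lborel :: (real ^ 3) measure). norm p \<notin> S"
    using nonneg by eventually_elim (simp add: lift3_def S_def)
  then have "(\<integral>\<^sup>+p. indicator S (norm p) \<partial>(lborel :: (real ^ 3) measure)) = 0"
    by (subst nn_integral_0_iff_AE) (auto elim!: eventually_mono)
  then have "(\<integral>\<^sup>+r. ennreal (4 * pi * r\<^sup>2) * indicator {0..} r * indicator S r \<partial>lborel) = 0"
    by (subst (asm) nn_integral_norm_real3) simp_all
  then have "AE r in lborel. ennreal (4 * pi * r\<^sup>2) * indicator {0..} r * indicator S r = 0"
    by (subst (asm) nn_integral_0_iff_AE) auto
  \<comment> \<open>The weight \<open>4 * pi * r^2\<close> vanishes only at the origin, so a null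
    set of points gives a null set of radii once 0 is discarded.\<close>
  then have AE: "AE r in lborel. ?f r = ?F r"
    using AE_lborel_singleton[of 0]
    by eventually_elim (auto simp: S_def positive_profile_def indicator_def split: if_splits)
  then show "AE r in lborel. 0 \<le> r \<longrightarrow> f r = ?F r"
    by eventually_elim (auto simp: indicator_def)
  have k: "(\<lambda>r. indicator {0..} r *\<^sub>R (f r * r ^ k)) = (\<lambda>r. r ^ k * ?f r)" for k
    by (auto simp: indicator_def)
  have AEk: "AE r in lborel. r ^ k * ?f r = r ^ k * ?F r" for k
    using AE by eventually_elim simp
  show "(\<integral>r. r ^ 3 * ?F r \<partial>lborel) = h3"
  proof -
    have "(\<integral>r. r ^ 3 * ?F r \<partial>lborel) = (\<integral>r. r ^ 3 * ?f r \<partial>lborel)"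
      using AEk[of 3] by (intro integral_cong_AE) (auto elim!: eventually_mono)
    also have "\<dots> = h3" using h3 unfolding line_moment_def set_lebesgue_integral_def k .
    finally show ?thesis .
  qed
  show "radial_profile ?F"
  proof
    show "?F \<in> borel_measurable borel" by measurable
    show nonneg: "0 \<le> ?F r" "r < 0 \<Longrightarrow> ?F r = 0" for r by (auto simp: positive_profile_def)
    have "integrable lborel (\<lambda>r. r ^ 8 * ?f r)"
      using m8 unfolding finite_moment_def set_integrable_def k .
    then show "integrable lborel (\<lambda>r. r ^ 8 * ?F r)"
      using AEk[of 8] by (subst (asm) integrable_cong_AE) auto
    have "(\<integral>\<^sup>+r. ennreal (4 * pi) * ennreal (r\<^sup>2 * ?F r) \<partial>lborel)
      = (\<integral>\<^sup>+r. ennreal (4 * pi * r\<^sup>2) * indicator {0..} r * ennreal (?F r) \<partial>lborel)"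
      by (intro nn_integral_cong) (auto simp: positive_profile_def indicator_def ennreal_mult' ac_simps)
    also have "\<dots> = (\<integral>\<^sup>+p. ennreal (?F (norm p)) \<partial>(lborel :: (real ^ 3) measure))"
      by (rule nn_integral_norm_real3[symmetric]) measurable
    also have "\<dots> \<le> (\<integral>\<^sup>+p. ennreal (norm (lift3 f p)) \<partial>lborel)"
      by (intro nn_integral_mono ennreal_leI) (auto simp: positive_profile_def lift3_def)
    also have "\<dots> < \<infinity>" using int by (simp add: integrable_iff_bounded)
    finally have "ennreal (4 * pi) * (\<integral>\<^sup>+r. ennreal (r\<^sup>2 * ?F r) \<partial>lborel) < \<infinity>"
      by (simp add: nn_integral_cmult)
    then have "(\<integral>\<^sup>+r. ennreal (r\<^sup>2 * ?F r) \<partial>lborel) < \<infinity>"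
      by (auto simp: ennreal_mult_less_top)
    then show "integrable lborel (\<lambda>r. r\<^sup>2 * ?F r)"
      using nonneg by (intro integrableI_nonneg) auto
  qed
qed

text \<open>Apart from the value at \<open>r\<close>, the operator sees \<open>f\<close> only under
  integrals, and the maps \<open>s \<mapsto> r - s\<close> and \<open>s \<mapsto> s - r\<close>
  preserve null sets. Since \<open>f\<close> is arbitrary on the negative axis, it is first cut off
  to \<open>f0\<close>.\<close>

lemma coll_cong_AE:
  assumes F: "radial_profile F" and f [measurable]: "(\<lambda>r. indicator {0..} r * f r) \<in> borel_measurable borel"
    and AE: "AE r in lborel. 0 \<le> r \<longrightarrow> f r = F r"
  shows "AE r in lborel. 0 \<le> r \<longrightarrow> coll f r = coll F r"
proof -
  interpret radial_profile F by fact
  define f0 where "f0 r = indicator {0..} r * f r" for r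
  have [measurable]: "f0 \<in> borel_measurable borel" using f unfolding f0_def[abs_def] .
  have AE0: "AE s in lborel. f0 s = F s"
    using AE by eventually_elim (auto simp: f0_def indicator_def F_negative)
  have shift: "AE s in lborel. f0 (r - s) = F (r - s)" "AE s in lborel. f0 (s - r) = F (s - r)" for r
    using AE_borel_affine[of "-1" "\<lambda>s. f0 s = F s" r] AE_borel_affine[of 1 "\<lambda>s. f0 s = F s" "- r"] AE0
    by simp_all
  have [measurable]: "coll_kernel r \<in> borel_measurable borel" "(\<lambda>s. coll_kernel s (r - s)) \<in> borel_measurable borel"
    "(\<lambda>s. coll_kernel r (s - r)) \<in> borel_measurable borel" for r
    unfolding coll_kernel_def[abs_def] by measurable
  have eq: "coll f r = coll F r" if r: "0 \<le> r" "f r = F r" for r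
  proof -
    have "(LBINT s:{0..r}. coll_kernel s (r - s) * f s * f (r - s)) = (LBINT s:{0..r}. coll_kernel s (r - s) * f0 s * f0 (r - s))"
      "(LBINT s:{r..}. coll_kernel r (s - r) * f s * f (s - r)) = (LBINT s:{r..}. coll_kernel r (s - r) * f0 s * f0 (s - r))"
      "(LBINT s:{r..}. coll_kernel r (s - r) * f s) = (LBINT s:{r..}. coll_kernel r (s - r) * f0 s)"
      "(LBINT s:{0..r}. coll_kernel s (r - s) * f s) = (LBINT s:{0..r}. coll_kernel s (r - s) * f0 s)"
      "(LBINT s:{0..}. coll_kernel r s * f s) = (LBINT s:{0..}. coll_kernel r s * f0 s)"
      using r by (auto intro!: set_lebesgue_integral_cong simp: f0_def)
    moreover have "(LBINT s:{0..r}. coll_kernel s (r - s) * f0 s * f0 (r - s)) = (LBINT s:{0..r}. coll_kernel s (r - s) * F s * F (r - s))"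
      unfolding set_lebesgue_integral_def
      by (rule integral_cong_AE, measurable) (use AE0 shift(1)[of r] in eventually_elim, simp)
    moreover have "(LBINT s:{r..}. coll_kernel r (s - r) * f0 s * f0 (s - r)) = (LBINT s:{r..}. coll_kernel r (s - r) * F s * F (s - r))"
      unfolding set_lebesgue_integral_def
      by (rule integral_cong_AE, measurable) (use AE0 shift(2)[of r] in eventually_elim, simp)
    moreover have "(LBINT s:{r..}. coll_kernel r (s - r) * f0 s) = (LBINT s:{r..}. coll_kernel r (s - r) * F s)"
      "(LBINT s:{0..r}. coll_kernel s (r - s) * f0 s) = (LBINT s:{0..r}. coll_kernel s (r - s) * F s)"
      "(LBINT s:{0..}. coll_kernel r s * f0 s) = (LBINT s:{0..}. coll_kernel r s * F s)"
      unfolding set_lebesgue_integral_def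
      by (rule integral_cong_AE, measurable, use AE0 in eventually_elim, simp)+
    ultimately show ?thesis
      using r by (simp add: coll_def quad_coll_def lin_coll_def)
  qed
  show ?thesis using AE by eventually_elim (use eq in blast)
qed

section \<open>Pairing with bounded functions, and a barrier argument\<close>

lemma L1_norm_radial:
  assumes [measurable]: "H \<in> borel_measurable borel" and AE: "AE r in lborel. 0 \<le> r \<longrightarrow> h r = H r"
  shows "L1_norm h = (\<integral>\<^sup>+r. ennreal (4 * pi * r\<^sup>2) * indicator {0..} r * ennreal \<bar>H r\<bar> \<partial>lborel)"
proof -
  have "L1_norm h = (\<integral>\<^sup>+p. ennreal \<bar>H (norm p)\<bar> \<partial>(lborel :: (real ^ 3) measure))"
    unfolding L1_norm_def using AE_norm_real3[OF AE]
    by (intro nn_integral_cong_AE) (auto elim!: eventually_mono simp: lift3_def)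
  also have "\<dots> = (\<integral>\<^sup>+r. ennreal (4 * pi * r\<^sup>2) * indicator {0..} r * ennreal \<bar>H r\<bar> \<partial>lborel)"
    by (rule nn_integral_norm_real3) measurable
  finally show ?thesis .
qed

lemma radial_pairing_le_L1_norm:
  assumes [measurable]: "H \<in> borel_measurable borel" and AE: "AE r in lborel. 0 \<le> r \<longrightarrow> h r = H r"
    and [measurable]: "g \<in> borel_measurable borel" and g: "\<And>r. 0 \<le> r \<Longrightarrow> \<bar>g r\<bar> \<le> C"
  shows "ennreal \<bar>\<integral>r. indicator {0..} r * (r\<^sup>2 * H r) * g r \<partial>lborel\<bar> \<le> ennreal (C / (4 * pi)) * L1_norm h"
proof (cases "integrable lborel (\<lambda>r. indicator {0..} r * (r\<^sup>2 * H r) * g r)")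
  case True
  have C: "0 \<le> C" using g[of 0] by simp
  have "ennreal \<bar>\<integral>r. indicator {0..} r * (r\<^sup>2 * H r) * g r \<partial>lborel\<bar>
    \<le> (\<integral>\<^sup>+r. ennreal \<bar>indicator {0..} r * (r\<^sup>2 * H r) * g r\<bar> \<partial>lborel)"
    using integral_norm_bound_ennreal[OF True] by simp
  also have "\<dots> \<le> (\<integral>\<^sup>+r. ennreal (C / (4 * pi)) * (ennreal (4 * pi * r\<^sup>2) * indicator {0..} r * ennreal \<bar>H r\<bar>) \<partial>lborel)"
  proof (intro nn_integral_mono)
    fix r :: real
    show "ennreal \<bar>indicator {0..} r * (r\<^sup>2 * H r) * g r\<bar>
      \<le> ennreal (C / (4 * pi)) * (ennreal (4 * pi * r\<^sup>2) * indicator {0..} r * ennreal \<bar>H r\<bar>)"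
    proof (cases "0 \<le> r")
      case True
      have "\<bar>r\<^sup>2 * H r * g r\<bar> \<le> C / (4 * pi) * (4 * pi * r\<^sup>2 * \<bar>H r\<bar>)"
        using mult_left_mono[OF g[OF True], of "r\<^sup>2 * \<bar>H r\<bar>"] by (simp add: abs_mult ac_simps)
      then have "ennreal \<bar>r\<^sup>2 * H r * g r\<bar> \<le> ennreal (C / (4 * pi) * (4 * pi * r\<^sup>2 * \<bar>H r\<bar>))"
        by (rule ennreal_leI)
      also have "\<dots> = ennreal (C / (4 * pi)) * (ennreal (4 * pi * r\<^sup>2) * ennreal \<bar>H r\<bar>)"
        using C by (subst ennreal_mult[symmetric] | simp)+
      finally show ?thesis using True by simp
    qed simp
  qed
  also have "\<dots> = ennreal (C / (4 * pi)) * L1_norm h"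
    unfolding L1_norm_radial[OF assms(1,2)] by (rule nn_integral_cmult) measurable
  finally show ?thesis .
\<comment> \<open>A non-integrable pairing has integral 0 by convention, so the bound is
  trivial.\<close>
qed (simp add: not_integrable_integral_eq)

lemma tendsto_0_if_le_L1_norm:
  fixes P :: "real \<Rightarrow> real"
  assumes L: "(L \<longlongrightarrow> 0) G" and le: "eventually (\<lambda>s. ennreal \<bar>P s\<bar> \<le> ennreal c * L s) G"
  shows "(P \<longlongrightarrow> 0) G"
proof -
  have lim: "((\<lambda>s. ennreal c * L s) \<longlongrightarrow> 0) G"
    using ennreal_tendsto_cmult[OF _ L, of "ennreal c"] by simp
  have "((\<lambda>s. ennreal \<bar>P s\<bar>) \<longlongrightarrow> ennreal 0) G"
    unfolding ennreal_0 by (rule tendsto_sandwich[OF _ le tendsto_const lim]) simp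
  then have "((\<lambda>s. \<bar>P s\<bar>) \<longlongrightarrow> 0) G" by (rule tendsto_ennrealD) auto
  then show ?thesis by (rule tendsto_rabs_zero_cancel)
qed

text \<open>Let \<open>v\<close> be the first time at which \<open>E\<close> reaches 2 and
  \<open>u\<close> the last time before it with \<open>E \<le> 1\<close>. In between
  \<open>E\<close> lies in the strip where the derivative is nonpositive, so
  \<open>E v \<le> E u\<close>, a contradiction.\<close>

lemma barrier:
  fixes E :: "real \<Rightarrow> real"
  assumes cont: "continuous_on {0..} E" and E0: "E 0 \<le> 1" and T: "0 \<le> T"
    and deriv: "\<And>t. 0 < t \<Longrightarrow> 1 \<le> E t \<Longrightarrow> E t \<le> 2 \<Longrightarrow>
      \<exists>d. (E has_real_derivative d) (at t within {0..}) \<and> d \<le> 0"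
  shows "E T \<le> 2"
proof (rule ccontr)
  assume ET: "\<not> E T \<le> 2"
  have cont_on: "continuous_on {a..b} E" if "0 \<le> a" for a b
    using that by (intro continuous_on_subset[OF cont]) auto
  define S where "S = {0..T} \<inter> E -` {2..}"
  have "closed S" unfolding S_def by (intro continuous_closed_preimage cont_on order_refl closed_atLeastAtMost closed_atLeast closed_atMost)
  moreover have S: "T \<in> S" "bdd_below S" using T ET by (auto simp: S_def intro!: bdd_belowI[of _ 0])
  ultimately have "Inf S \<in> S" by (intro closed_contains_Inf) auto
  define v where "v = Inf S"
  have v: "0 \<le> v" "2 \<le> E v" using \<open>Inf S \<in> S\<close> by (auto simp: S_def v_def)
  have below: "E t < 2" if "0 \<le> t" "t < v" for t
  proof (rule ccontr)
    assume "\<not> E t < 2"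
    then have "t \<in> S" using that \<open>Inf S \<in> S\<close> by (auto simp: S_def v_def)
    then show False using that cInf_lower[OF _ S(2), of t] by (simp add: v_def)
  qed
  define U where "U = {0..v} \<inter> E -` {..1}"
  have "closed U" unfolding U_def by (intro continuous_closed_preimage cont_on order_refl closed_atLeastAtMost closed_atLeast closed_atMost)
  moreover have U: "0 \<in> U" "bdd_above U" using v E0 by (auto simp: U_def intro!: bdd_aboveI[of _ v])
  ultimately have "Sup U \<in> U" by (intro closed_contains_Sup) auto
  define u where "u = Sup U"
  have u: "0 \<le> u" "u \<le> v" "E u \<le> 1" using \<open>Sup U \<in> U\<close> by (auto simp: U_def u_def)
  have above: "1 < E t" if "u < t" "t \<le> v" for t
  proof (rule ccontr)
    assume "\<not> 1 < E t"
    then have "t \<in> U" using that u by (auto simp: U_def)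
    then show False using that cSup_upper[OF _ U(2), of t] by (simp add: u_def)
  qed
  have "u \<noteq> v" using u v by auto
  then have "u < v" using u by simp
  have "E v \<le> E u"
  proof (rule DERIV_nonpos_imp_decreasing_open[where f = E and a = u and b = v])
    show "u \<le> v" using u by simp
    show "continuous_on {u..v} E" using u(1) by (rule cont_on)
    fix t assume t: "u < t" "t < v"
    then have "1 \<le> E t" "E t \<le> 2" "0 < t" using above[of t] below[of t] u by auto
    then obtain d where d: "(E has_real_derivative d) (at t within {0..})" "d \<le> 0" using deriv by blast
    then have "(E has_real_derivative d) (at t)"
      using \<open>0 < t\<close> at_within_interior[of t "{0..}"] by simp
    then show "\<exists>d. (E has_real_derivative d) (at t) \<and> d \<le> 0" using d by blast
  qed
  then show False using u v by simp
qed

text \<open>The weighted mass is a constant plus the pairing with the bounded function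
  \<open>g\<close>, so it inherits continuity and its derivative from the \<open>L1_norm\<close>
  limits in \<open>bec_solution\<close>. Then \<open>barrier\<close> applies through
  \<open>coll_\<phi>N_nonpos\<close>.\<close>

lemma (in series_weight) weighted_mass_le:
  assumes sol: "bec_solution \<kappa>0 {0..} (invariant_set h3 h8 hinf) f nc" and \<kappa>0: "0 < \<kappa>0"
    and R0: "0 < R0" "R0 \<le> N"
    and small: "\<phi> R0 / R0 * h3 \<le> 1 / (2 * (4 * pi))"
    and large: "16 / (4 * pi) \<le> R0 ^ 3 / (243 * (1 + b 0 / (b 1 * R0)))"
    and init: "4 * pi * (\<integral>r. r\<^sup>2 * positive_profile (f 0) r * \<phi>N N r \<partial>lborel) \<le> 1"
    and t: "0 \<le> t"
  shows "4 * pi * (\<integral>r. r\<^sup>2 * positive_profile (f t) r * \<phi>N N r \<partial>lborel) \<le> 2"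
proof -
  have N: "0 < N" using R0 by simp
  define F where "F t = positive_profile (f t)" for t
  define g where "g r = \<phi>N N r - slope N * r" for r
  define C where "C = slope N * N"
  have [measurable]: "g \<in> borel_measurable borel" unfolding g_def[abs_def] by measurable
  have g: "\<bar>g r\<bar> \<le> C" if "0 \<le> r" for r using \<phi>N_bounded[OF N that] by (simp add: g_def C_def)
  define P where "P t = (\<integral>r. indicator {0..} r * (r\<^sup>2 * F t r) * g r \<partial>lborel)" for t
  define Q where "Q t = (\<integral>r. indicator {0..} r * (r\<^sup>2 * coll (F t) r) * g r \<partial>lborel)" for t
  define E where "E t = 4 * pi * (\<integral>r. r\<^sup>2 * F t r * \<phi>N N r \<partial>lborel)" for t
  have inv: "f t \<in> invariant_set h3 h8 hinf" and nc: "0 < nc t" if "0 \<le> t" for t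
    using sol that by (auto simp: bec_solution_def)
  have prof: "radial_profile (F t)" and h3: "(\<integral>r. r ^ 3 * F t r \<partial>lborel) = h3"
    and AE: "AE r in lborel. 0 \<le> r \<longrightarrow> f t r = F t r"
    and AE_coll: "AE r in lborel. 0 \<le> r \<longrightarrow> coll (f t) r = coll (F t) r" if "0 \<le> t" for t
    using invariant_set_profile[OF inv[OF that]] coll_cong_AE[of "F t" "f t"] by (auto simp: F_def)
  have wprof: "weighted_profile b (F t)" if "0 \<le> t" for t
    using prof[OF that] series_weight_axioms by (simp add: weighted_profile_def)
  have meas [measurable]: "F t \<in> borel_measurable borel" "coll (F t) \<in> borel_measurable borel" if "0 \<le> t" for t
    using radial_profile.F_measurable[OF prof[OF that]] radial_profile.coll_measurable[OF prof[OF that]] by auto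
  \<comment> \<open>The subtracted linear part contributes \<open>slope N * h3\<close> at every
    time, because the invariant set fixes the third moment.\<close>
  have int: "integrable lborel (\<lambda>r. indicator {0..} r * (r\<^sup>2 * F t r) * g r)"
    and E_eq: "E t = 4 * pi * (P t + slope N * h3)" if t: "0 \<le> t" for t
  proof -
    interpret weighted_profile b "F t" by (rule wprof[OF t])
    have eq: "indicator {0..} r * (r\<^sup>2 * F t r) * g r = r\<^sup>2 * F t r * \<phi>N N r - slope N * (r ^ 3 * F t r)" for r
      by (cases "r < 0") (auto simp: g_def F_negative algebra_simps power2_eq_square power3_eq_cube)
    have i: "integrable lborel (\<lambda>r. r\<^sup>2 * F t r * \<phi>N N r)" "integrable lborel (\<lambda>r. slope N * (r ^ 3 * F t r))"
      using \<phi>N_moment[OF N, of 2] F_moment[of 3] by auto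
    show "integrable lborel (\<lambda>r. indicator {0..} r * (r\<^sup>2 * F t r) * g r)"
      unfolding eq using i by (rule Bochner_Integration.integrable_diff)
    have "P t = (\<integral>r. r\<^sup>2 * F t r * \<phi>N N r \<partial>lborel) - slope N * h3"
      unfolding P_def eq using i h3[OF t] by (subst Bochner_Integration.integral_diff) auto
    then show "E t = 4 * pi * (P t + slope N * h3)" by (simp add: E_def)
  qed
  have intQ: "integrable lborel (\<lambda>r. indicator {0..} r * (r\<^sup>2 * coll (F t) r) * g r)" if "0 \<le> t" for t
    using radial_profile.coll_weak_form(1)[OF prof[OF that], of g C] g by simp
  have cont: "continuous_on {0..} E"
    unfolding continuous_on_def
  proof
    fix t :: real assume "t \<in> {0..}"
    then have t: "0 \<le> t" by simp
    have L: "((\<lambda>s. L1_norm (\<lambda>r. f s r - f t r)) \<longlongrightarrow> 0) (at t within {0..})"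
      using sol t by (auto simp: bec_solution_def)
    have "((\<lambda>s. P s - P t) \<longlongrightarrow> 0) (at t within {0..})"
    proof (rule tendsto_0_if_le_L1_norm[OF L, where c = "C / (4 * pi)"])
      show "eventually (\<lambda>s. ennreal \<bar>P s - P t\<bar> \<le> ennreal (C / (4 * pi)) * L1_norm (\<lambda>r. f s r - f t r)) (at t within {0..})"
        unfolding eventually_at_filter
      proof (intro always_eventually allI impI)
        fix s :: real assume "s \<in> {0..}"
        then have s: "0 \<le> s" by simp
        have "P s - P t = (\<integral>r. indicator {0..} r * (r\<^sup>2 * (F s r - F t r)) * g r \<partial>lborel)"
          unfolding P_def using int[OF s] int[OF t]
          by (subst Bochner_Integration.integral_diff[symmetric]) (auto simp: algebra_simps)
        moreover have "AE r in lborel. 0 \<le> r \<longrightarrow> f s r - f t r = F s r - F t r"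
          using AE[OF s] AE[OF t] by eventually_elim simp
        ultimately show "ennreal \<bar>P s - P t\<bar> \<le> ennreal (C / (4 * pi)) * L1_norm (\<lambda>r. f s r - f t r)"
          using radial_pairing_le_L1_norm[of "\<lambda>r. F s r - F t r" _ g C] meas s t g by simp
      qed
    qed
    then have "(P \<longlongrightarrow> P t) (at t within {0..})" by (simp add: LIM_zero_iff)
    then have "((\<lambda>s. 4 * pi * (P s + slope N * h3)) \<longlongrightarrow> 4 * pi * (P t + slope N * h3)) (at t within {0..})"
      by (intro tendsto_intros)
    moreover have "eventually (\<lambda>s. 4 * pi * (P s + slope N * h3) = E s) (at t within {0..})"
      unfolding eventually_at_filter using E_eq by (intro always_eventually) auto
    ultimately show "(E \<longlongrightarrow> E t) (at t within {0..})"
      unfolding E_eq[OF t] by (rule Lim_transform_eventually)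
  qed
  have deriv: "(P has_real_derivative \<kappa>0 / nc t * Q t) (at t within {0..})" if "0 < t" for t
  proof -
    have t: "0 \<le> t" using that by simp
    let ?d = "\<lambda>s r. (f s r - f t r) / (s - t) - \<kappa>0 / nc t * coll (f t) r"
    let ?D = "\<lambda>s r. (F s r - F t r) / (s - t) - \<kappa>0 / nc t * coll (F t) r"
    have L: "((\<lambda>s. L1_norm (?d s)) \<longlongrightarrow> 0) (at t within {0..})"
      using sol that by (auto simp: bec_solution_def)
    have "((\<lambda>s. (P s - P t) / (s - t) - \<kappa>0 / nc t * Q t) \<longlongrightarrow> 0) (at t within {0..})"
    proof (rule tendsto_0_if_le_L1_norm[OF L, where c = "C / (4 * pi)"])
      show "eventually (\<lambda>s. ennreal \<bar>(P s - P t) / (s - t) - \<kappa>0 / nc t * Q t\<bar>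
          \<le> ennreal (C / (4 * pi)) * L1_norm (?d s)) (at t within {0..})"
        unfolding eventually_at_filter
      proof (intro always_eventually allI impI)
        fix s :: real assume "s \<in> {0..}"
        then have s: "0 \<le> s" by simp
        have "(\<integral>r. indicator {0..} r * (r\<^sup>2 * ?D s r) * g r \<partial>lborel)
          = (\<integral>r. (indicator {0..} r * (r\<^sup>2 * F s r) * g r - indicator {0..} r * (r\<^sup>2 * F t r) * g r) / (s - t)
            - \<kappa>0 / nc t * (indicator {0..} r * (r\<^sup>2 * coll (F t) r) * g r) \<partial>lborel)"
          by (intro Bochner_Integration.integral_cong) (auto simp: indicator_def diff_divide_distrib algebra_simps)
        also have "\<dots> = (P s - P t) / (s - t) - \<kappa>0 / nc t * Q t"
          unfolding P_def Q_def using int[OF s] int[OF t] intQ[OF t] by simp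
        finally have "(P s - P t) / (s - t) - \<kappa>0 / nc t * Q t = (\<integral>r. indicator {0..} r * (r\<^sup>2 * ?D s r) * g r \<partial>lborel)" ..
        moreover have "AE r in lborel. 0 \<le> r \<longrightarrow> ?d s r = ?D s r"
          using AE[OF s] AE[OF t] AE_coll[OF t] by eventually_elim simp
        moreover have "?D s \<in> borel_measurable borel" using meas s t by measurable
        ultimately show "ennreal \<bar>(P s - P t) / (s - t) - \<kappa>0 / nc t * Q t\<bar>
          \<le> ennreal (C / (4 * pi)) * L1_norm (?d s)"
          using radial_pairing_le_L1_norm[of "?D s" "?d s" g C] g by simp
      qed
    qed
    then show ?thesis by (simp add: has_field_derivative_iff LIM_zero_iff)
  qed
  have "E t \<le> 2"
  proof (rule barrier[OF cont _ t])
    show "E 0 \<le> 1" using init by (simp add: E_def F_def)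
    fix t :: real assume t: "0 < t" and E: "1 \<le> E t" "E t \<le> 2"
    interpret weighted_profile b "F t" using t by (intro wprof) simp
    have "Q t \<le> 0"
      unfolding Q_def g_def using coll_\<phi>N_nonpos[OF R0, of "4 * pi"] small large E h3[of t] t
      by (simp add: E_def)
    then have le: "4 * pi * (\<kappa>0 / nc t * Q t) \<le> 0"
      using nc[of t] \<kappa>0 t by (intro mult_nonneg_nonpos) auto
    have "((\<lambda>s. 4 * pi * (P s + slope N * h3)) has_real_derivative 4 * pi * (\<kappa>0 / nc t * Q t)) (at t within {0..})"
      using deriv[OF t] by (auto intro!: derivative_eq_intros)
    then have "(E has_real_derivative 4 * pi * (\<kappa>0 / nc t * Q t)) (at t within {0..})"
      \<comment> \<open>The formula for \<open>E\<close> holds at all nonnegative times, so the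
        radius 1 is arbitrary.\<close>
      by (rule has_field_derivative_transform_within[OF _ zero_less_one]) (use t E_eq in auto)
    then show "\<exists>d. (E has_real_derivative d) (at t within {0..}) \<and> d \<le> 0" using le by blast
  qed
  then show ?thesis by (simp add: E_def F_def)
qed

section \<open>Mittag-Leffler weights\<close>

lemma nn_integral_lift3_weight:
  assumes f: "f \<in> invariant_set h3 h8 hinf"
    and h [measurable]: "h \<in> borel_measurable borel" "\<And>r. 0 \<le> r \<Longrightarrow> 0 \<le> h r"
    and int: "integrable lborel (\<lambda>r. r\<^sup>2 * positive_profile f r * h r)"
  shows "(\<integral>\<^sup>+p. ennreal (lift3 f p * h (norm p)) \<partial>lborel)
    = ennreal (4 * pi * (\<integral>r. r\<^sup>2 * positive_profile f r * h r \<partial>lborel))"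
proof -
  let ?F = "positive_profile f"
  interpret radial_profile ?F by (rule invariant_set_profile[OF f])
  have Fh: "0 \<le> ?F r * h r" for r
    using F_nonneg[of r] h(2)[of r] by (cases "r < 0") (auto simp: F_negative)
  have "(\<integral>\<^sup>+p. ennreal (lift3 f p * h (norm p)) \<partial>lborel)
    = (\<integral>\<^sup>+p. ennreal (?F (norm p) * h (norm p)) \<partial>(lborel :: (real ^ 3) measure))"
    using AE_norm_real3[OF invariant_set_profile(1)[OF f]]
    by (intro nn_integral_cong_AE) (auto elim!: eventually_mono simp: lift3_def)
  also have "\<dots> = (\<integral>\<^sup>+r. ennreal (4 * pi * r\<^sup>2) * indicator {0..} r * ennreal (?F r * h r) \<partial>lborel)"
    by (rule nn_integral_norm_real3) measurable
  also have "\<dots> = (\<integral>\<^sup>+r. ennreal (4 * pi * (r\<^sup>2 * ?F r * h r)) \<partial>lborel)"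
  proof (intro nn_integral_cong)
    fix r :: real
    show "ennreal (4 * pi * r\<^sup>2) * indicator {0..} r * ennreal (?F r * h r) = ennreal (4 * pi * (r\<^sup>2 * ?F r * h r))"
      using Fh[of r] by (cases "r < 0") (simp_all add: F_negative ac_simps flip: ennreal_mult)
  qed
  also have "\<dots> = ennreal (\<integral>r. 4 * pi * (r\<^sup>2 * ?F r * h r) \<partial>lborel)"
    using int Fh by (intro nn_integral_eq_integral) (auto simp: mult.assoc)
  finally show ?thesis by simp
qed

text \<open>Identifies \<open>h3\<close> through the energy, which is what allows the rate to be
  chosen in terms of \<open>M1\<close>.\<close>

lemma energy_eq:
  assumes f: "f \<in> invariant_set h3 h8 hinf" and h3: "0 \<le> h3"
  shows "energy f = 4 * pi * h3"
proof -
  interpret radial_profile "positive_profile f" by (rule invariant_set_profile[OF f])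
  have eq: "r\<^sup>2 * positive_profile f r * \<bar>r\<bar> = r ^ 3 * positive_profile f r" for r
    by (cases "r < 0") (auto simp: F_negative power2_eq_square power3_eq_cube)
  have [measurable]: "lift3 f \<in> borel_measurable borel" and nonneg: "AE p in lborel. 0 \<le> lift3 f p"
    using f by (auto simp: invariant_set_def)
  have "energy f = enn2real (\<integral>\<^sup>+p. ennreal (lift3 f p * norm p) \<partial>lborel)"
    unfolding energy_def using nonneg by (intro integral_eq_nn_integral) (auto elim!: eventually_mono)
  also have "(\<integral>\<^sup>+p. ennreal (lift3 f p * norm p) \<partial>lborel) = ennreal (4 * pi * h3)"
    using nn_integral_lift3_weight[OF f, of abs] F_moment[of 3] invariant_set_profile(3)[OF f]
    by (simp add: eq)
  finally show ?thesis using h3 by simp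
qed

section \<open>Mittag-Leffler functions as series weights\<close>

definition ml_coeff :: "real \<Rightarrow> real \<Rightarrow> nat \<Rightarrow> real" where
  "ml_coeff a \<beta> k = \<beta> ^ Suc k / Gamma (a * real (Suc k) + 1)"

text \<open>Summability follows by comparison with the exponential series, since the Gamma
  denominators dominate \<open>fact k\<close>. Submultiplicativity is
  \<open>Gamma_product_le\<close>, whose values at \<open>a = 1\<close> form the binomial
  coefficient.\<close>

lemma series_weight_ml_coeff:
  assumes a: "1 \<le> a" and \<beta>: "0 < \<beta>"
  shows "series_weight (ml_coeff a \<beta>)"
proof
  have arg: "0 < a * real (Suc k) + 1" for k
    using a by (intro add_nonneg_pos mult_nonneg_nonneg) auto
  show "0 < ml_coeff a \<beta> k" for k
    unfolding ml_coeff_def using \<beta> arg by (intro divide_pos_pos zero_less_power Gamma_real_pos)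
  have fact_le: "fact k \<le> Gamma (a * real (Suc k) + 1)" for k
  proof -
    have "fact k \<le> (fact (Suc k) :: real)" by (rule fact_mono) simp
    also have "\<dots> = Gamma (1 + real (Suc k))" by (rule Gamma_fact[symmetric])
    also have "\<dots> \<le> Gamma (a * real (Suc k) + 1)"
    proof -
      have "real (Suc k) \<le> a * real (Suc k)" using mult_right_mono[OF a, of "real (Suc k)"] by simp
      then consider "1 + real (Suc k) = a * real (Suc k) + 1" | "1 + real (Suc k) < a * real (Suc k) + 1"
        by linarith
      then show ?thesis
      proof cases
        case 2
        then show ?thesis by (intro less_imp_le Gamma_real_strict_mono) auto
      qed simp
    qed
    finally show ?thesis .
  qed
  show "summable (\<lambda>k. ml_coeff a \<beta> k * r ^ k)" for r
  proof (rule summable_comparison_test)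
    show "summable (\<lambda>k. \<beta> * (inverse (fact k) * (\<beta> * \<bar>r\<bar>) ^ k))"
      by (intro summable_mult summable_exp)
    have "norm (ml_coeff a \<beta> k * r ^ k) \<le> \<beta> * (inverse (fact k) * (\<beta> * \<bar>r\<bar>) ^ k)" for k
    proof -
      have "norm (ml_coeff a \<beta> k * r ^ k) = \<beta> ^ Suc k * \<bar>r\<bar> ^ k / Gamma (a * real (Suc k) + 1)"
        using \<beta> Gamma_real_pos[OF arg[of k]] by (simp add: ml_coeff_def abs_mult power_abs)
      also have "\<dots> \<le> \<beta> ^ Suc k * \<bar>r\<bar> ^ k / fact k"
        using fact_le[of k] \<beta> Gamma_real_pos[OF arg[of k]] by (intro divide_left_mono mult_pos_pos) auto
      finally show ?thesis by (simp add: power_mult_distrib field_simps)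
    qed
    then show "\<exists>M. \<forall>k\<ge>M. norm (ml_coeff a \<beta> k * r ^ k) \<le> \<beta> * (inverse (fact k) * (\<beta> * \<bar>r\<bar>) ^ k)" by blast
  qed
  show "real ((i + j + 2) choose (i + 1)) * ml_coeff a \<beta> (i + j + 1) \<le> ml_coeff a \<beta> i * ml_coeff a \<beta> j" for i j
  proof -
    define x y where "x = real (Suc i)" and "y = real (Suc j)"
    have xy: "real (Suc (i + j + 1)) = x + y" by (simp add: x_def y_def)
    have G: "Gamma (x + 1) = fact (Suc i)" "Gamma (y + 1) = fact (Suc j)" "Gamma (x + y + 1) = fact (i + j + 2)"
      using Gamma_fact[of "Suc i"] Gamma_fact[of "Suc j"] Gamma_fact[of "i + j + 2"]
      by (simp_all add: x_def y_def add_ac)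
    have choose: "real ((i + j + 2) choose (i + 1)) = Gamma (x + y + 1) / (Gamma (x + 1) * Gamma (y + 1))"
      unfolding G by (subst binomial_fact) auto
    have pos: "0 < Gamma (a * x + 1)" "0 < Gamma (a * y + 1)" "0 < Gamma (a * (x + y) + 1)"
      using arg[of i] arg[of j] arg[of "i + j + 1"] unfolding xy[symmetric] x_def y_def by (auto intro: Gamma_real_pos)
    have pos': "0 < Gamma (x + 1)" "0 < Gamma (y + 1)" unfolding G by (rule fact_gt_zero)+
    have "Gamma (x + y + 1) / (Gamma (x + 1) * Gamma (y + 1)) / Gamma (a * (x + y) + 1)
      \<le> 1 / (Gamma (a * x + 1) * Gamma (a * y + 1))"
      using Gamma_product_le[of x y a] a pos pos' by (simp add: x_def y_def field_simps)
    then have "\<beta> ^ (i + j + 2) * (Gamma (x + y + 1) / (Gamma (x + 1) * Gamma (y + 1)) / Gamma (a * (x + y) + 1))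
      \<le> \<beta> ^ (i + j + 2) * (1 / (Gamma (a * x + 1) * Gamma (a * y + 1)))"
      using \<beta> by (intro mult_left_mono) auto
    then show ?thesis
      unfolding choose ml_coeff_def xy x_def[symmetric] y_def[symmetric]
      by (simp add: power_add power2_eq_square ac_simps)
  qed
qed

lemma mittag_leffler_eq_\<phi>:
  assumes "1 \<le> a" "0 < \<beta>"
  shows "mittag_leffler a (\<beta> * r) = series_weight.\<phi> (ml_coeff a \<beta>) r"
proof -
  interpret series_weight "ml_coeff a \<beta>" by (rule series_weight_ml_coeff[OF assms])
  show ?thesis
    unfolding \<phi>_def mittag_leffler_def ml_coeff_def
    by (simp only: power_mult_distrib times_divide_eq_left)
qed

lemma mittag_leffler_mono:
  assumes "1 \<le> a" "0 \<le> x" "x \<le> y"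
  shows "mittag_leffler a x \<le> mittag_leffler a y"
  using series_weight.\<phi>_mono[OF series_weight_ml_coeff[OF assms(1) zero_less_one] assms(2,3)]
    mittag_leffler_eq_\<phi>[OF assms(1) zero_less_one] by simp

lemma mittag_leffler_le_linear:
  assumes "1 \<le> a" "0 \<le> u" "u \<le> 1"
  shows "mittag_leffler a u \<le> u * mittag_leffler a 1"
  using series_weight.\<phi>_starshaped[OF series_weight_ml_coeff[OF assms(1) zero_less_one] assms(2,3)]
    mittag_leffler_eq_\<phi>[OF assms(1) zero_less_one] by simp

lemma mittag_leffler_nonneg:
  assumes "1 \<le> a" "0 \<le> x"
  shows "0 \<le> mittag_leffler a x"
  using series_weight.\<phi>_nonneg[OF series_weight_ml_coeff[OF assms(1) zero_less_one] assms(2)]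
    mittag_leffler_eq_\<phi>[OF assms(1) zero_less_one] by simp

text \<open>\<open>weighted_mass_le\<close> bounds the extended weights by 2 uniformly in
  \<open>N\<close>; Fatou's lemma then removes the extension.\<close>

lemma ml_integral_le:
  assumes a: "1 \<le> a" and \<beta>: "0 < \<beta>" "\<beta> \<le> 1" "\<beta> \<le> \<alpha>0 powr a" and \<alpha>: "\<alpha> powr a = \<beta>"
    and small: "\<beta> * mittag_leffler a 1 * h3 \<le> 1 / (2 * (4 * pi))"
    and large: "\<beta> * (972 * (1 + Gamma (2 * a + 1) / Gamma (a + 1))) \<le> 1"
    and h3: "0 \<le> h3" and \<kappa>0: "0 < \<kappa>0"
    and sol: "bec_solution \<kappa>0 {0..} (invariant_set h3 h8 hinf) f nc"
    and init: "ml_integral a \<alpha>0 (f 0) \<le> 1" and t: "0 \<le> t"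
  shows "ml_integral a \<alpha> (f t) \<le> 2"
proof -
  interpret series_weight "ml_coeff a \<beta>" by (rule series_weight_ml_coeff[OF a \<beta>(1)])
  have \<phi>: "\<phi> r = mittag_leffler a (\<beta> * r)" for r using mittag_leffler_eq_\<phi>[OF a \<beta>(1)] by simp
  have inv: "f t \<in> invariant_set h3 h8 hinf" if "0 \<le> t" for t
    using sol that by (auto simp: bec_solution_def)
  have meas: "lift3 (f t) \<in> borel_measurable borel" and nonneg: "AE p in lborel. 0 \<le> lift3 (f t) p"
    if "0 \<le> t" for t
    using inv[OF that] by (auto simp: invariant_set_def)
  have mass: "(\<integral>\<^sup>+p. ennreal (lift3 (f t) p * \<phi>N N (norm p)) \<partial>lborel)
    = ennreal (4 * pi * (\<integral>r. r\<^sup>2 * positive_profile (f t) r * \<phi>N N r \<partial>lborel))"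
    if "0 \<le> t" "0 < N" for t N
  proof (rule nn_integral_lift3_weight[OF inv])
    interpret weighted_profile "ml_coeff a \<beta>" "positive_profile (f t)"
      using invariant_set_profile(2)[OF inv[OF that(1)]] series_weight_axioms by (simp add: weighted_profile_def)
    show "integrable lborel (\<lambda>r. r\<^sup>2 * positive_profile (f t) r * \<phi>N N r)"
      using that by (intro \<phi>N_moment) auto
  qed (use that \<phi>N_nonneg in auto)
  \<comment> \<open>This scale makes \<open>\<beta> * R0\<close> small, so
    \<open>\<phi> R0 / R0\<close> is of order \<open>\<beta>\<close>, while the loss constant is
    still of order \<open>1 / \<beta>\<close>.\<close>
  define R0 where "R0 = 1 / sqrt \<beta>"
  have R0: "0 < R0" "\<beta> * R0 = sqrt \<beta>" using \<beta> by (auto simp: R0_def real_div_sqrt)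
  have bound: "(\<integral>\<^sup>+p. ennreal (lift3 (f t) p * \<phi>N N (norm p)) \<partial>lborel) \<le> 2" if N: "R0 \<le> N" for N
  proof -
    have N0: "0 < N" using N R0 by simp
    have "(\<integral>\<^sup>+p. ennreal (lift3 (f 0) p * \<phi>N N (norm p)) \<partial>lborel)
      \<le> (\<integral>\<^sup>+p. ennreal (lift3 (f 0) p * mittag_leffler a (\<alpha>0 powr a * norm p)) \<partial>lborel)"
      using nonneg[OF order_refl]
    proof (intro nn_integral_mono_AE, eventually_elim, intro ennreal_leI mult_left_mono)
      fix p :: "real ^ 3"
      have "\<phi>N N (norm p) \<le> mittag_leffler a (\<beta> * norm p)" using \<phi>N_le_\<phi>[OF N0, of "norm p"] by (simp add: \<phi>)
      also have "\<dots> \<le> mittag_leffler a (\<alpha>0 powr a * norm p)"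
        using \<beta> by (intro mittag_leffler_mono a mult_right_mono) auto
      finally show "\<phi>N N (norm p) \<le> mittag_leffler a (\<alpha>0 powr a * norm p)" .
    qed
    also have "\<dots> \<le> 1" using init by (simp add: ml_integral_def)
    finally have "4 * pi * (\<integral>r. r\<^sup>2 * positive_profile (f 0) r * \<phi>N N r \<partial>lborel) \<le> 1"
      by (simp add: mass[OF order_refl N0])
    moreover have "\<phi> R0 / R0 * h3 \<le> 1 / (2 * (4 * pi))"
    proof -
      have "\<phi> R0 / R0 \<le> sqrt \<beta> * mittag_leffler a 1 / R0"
        unfolding \<phi> R0(2) using R0 \<beta> a by (intro divide_right_mono mittag_leffler_le_linear) auto
      also have "\<dots> = \<beta> * mittag_leffler a 1" using \<beta> by (simp add: R0_def)
      finally have "\<phi> R0 / R0 * h3 \<le> \<beta> * mittag_leffler a 1 * h3" using h3 by (intro mult_right_mono)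
      then show ?thesis using small by simp
    qed
    moreover have "16 / (4 * pi) \<le> R0 ^ 3 / (243 * (1 + ml_coeff a \<beta> 0 / (ml_coeff a \<beta> 1 * R0)))"
    proof -
      define G where "G = Gamma (2 * a + 1) / Gamma (a + 1)"
      have G: "0 < G" using a by (simp add: G_def)
      define u where "u = sqrt \<beta>"
      have u: "0 < u" "u \<le> 1" "\<beta> = u\<^sup>2" "R0 = 1 / u" using \<beta> by (auto simp: u_def R0_def)
      have q: "ml_coeff a \<beta> 0 / (ml_coeff a \<beta> 1 * R0) = G / u"
        using u(1) a by (simp add: ml_coeff_def G_def u(3,4) power2_eq_square mult.commute)
      \<comment> \<open>The target 4 explains the constant in \<open>large\<close>:
        \<open>972 = 4 * 243\<close>.\<close>
      have "16 / (4 * pi) \<le> (4 :: real)" using pi_gt3 by (simp add: field_simps)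
      also have "4 \<le> 1 / (243 * (1 + G) * u\<^sup>2)"
      proof -
        have "u\<^sup>2 * (972 * (1 + G)) \<le> 1" using large unfolding G_def u(3) .
        then show ?thesis using u(1) G by (subst pos_le_divide_eq) (auto simp: algebra_simps intro!: add_pos_pos)
      qed
      also have "\<dots> \<le> 1 / (243 * (u + G) * u\<^sup>2)"
        using u G by (intro divide_left_mono mult_right_mono mult_left_mono) auto
      also have "\<dots> = R0 ^ 3 / (243 * (1 + ml_coeff a \<beta> 0 / (ml_coeff a \<beta> 1 * R0)))"
        unfolding q unfolding u(4) using u(1) G by (simp add: field_simps eval_nat_numeral)
      finally show ?thesis .
    qed
    ultimately have "4 * pi * (\<integral>r. r\<^sup>2 * positive_profile (f t) r * \<phi>N N r \<partial>lborel) \<le> 2"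
      using weighted_mass_le[OF sol \<kappa>0 R0(1) N] t by blast
    then show ?thesis unfolding mass[OF t N0] by (metis ennreal_leI ennreal_numeral zero_le_numeral)
  qed
  have [measurable]: "lift3 (f t) \<in> borel_measurable borel" by (rule meas[OF t])
  \<comment> \<open>At each point the sequence is eventually constant, since the extension equals
    \<open>\<phi>\<close> up to \<open>N\<close>.\<close>
  have lim: "(\<lambda>n. ennreal (lift3 (f t) p * \<phi>N (R0 + real n) (norm p))) \<longlonglongrightarrow> ennreal (lift3 (f t) p * \<phi> (norm p))" for p
  proof (rule tendsto_eventually)
    obtain m :: nat where m: "norm p \<le> real m" using real_arch_simple by blast
    show "eventually (\<lambda>n. ennreal (lift3 (f t) p * \<phi>N (R0 + real n) (norm p)) = ennreal (lift3 (f t) p * \<phi> (norm p))) sequentially"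
      using eventually_ge_at_top[of m]
    proof eventually_elim
      case (elim n)
      then have "norm p \<le> R0 + real n" using m R0(1) by linarith
      then show ?case by (simp add: \<phi>N_def linear_extension_def)
    qed
  qed
  have "ml_integral a \<alpha> (f t) = (\<integral>\<^sup>+p. liminf (\<lambda>n. ennreal (lift3 (f t) p * \<phi>N (R0 + real n) (norm p))) \<partial>lborel)"
    using lim_imp_Liminf[OF sequentially_bot lim] by (simp add: ml_integral_def \<alpha> \<phi>)
  also have "\<dots> \<le> liminf (\<lambda>n. \<integral>\<^sup>+p. ennreal (lift3 (f t) p * \<phi>N (R0 + real n) (norm p)) \<partial>lborel)"
    by (rule nn_integral_liminf) measurable
  also have "\<dots> \<le> limsup (\<lambda>n. \<integral>\<^sup>+p. ennreal (lift3 (f t) p * \<phi>N (R0 + real n) (norm p)) \<partial>lborel)"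
    by (rule Liminf_le_Limsup) simp
  also have "\<dots> \<le> 2" using bound by (intro Limsup_bounded) auto
  finally show ?thesis .
qed

section \<open>Choice of the rate and conclusion\<close>

theorem theorem7p1:
  fixes M1 \<alpha>0 a :: real
  assumes "0 < \<alpha>0" and "1 \<le> a"
  shows "\<exists>\<alpha>>0. \<forall>\<kappa>0 C8 c8 C \<delta> h3 hinf f nc f0 n0.
    0 < \<kappa>0 \<and> m8_constants C8 c8 \<and> m4_constant C \<and> 0 < \<delta> \<and> 0 < h3 \<and> 0 < hinf \<and>
    bec_solution \<kappa>0 {0..} (invariant_set h3 (h8_bound \<kappa>0 \<delta> C8 c8 h3) hinf) f nc \<and>
    f 0 = f0 \<and> nc 0 = n0 \<and> 0 < n0 \<and>
    n0 \<ge> threshold C f0 - line_moment 2 f0 + \<delta> \<and>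
    energy f0 = M1 \<and>
    ml_integral a \<alpha>0 f0 \<le> 1
    \<longrightarrow> (SUP t\<in>{0..}. ml_integral a \<alpha> (f t)) \<le> 2"
proof -
  define S where "S = mittag_leffler a 1"
  define G where "G = Gamma (2 * a + 1) / Gamma (a + 1)"
  \<comment> \<open>The entries give, in order, \<open>\<beta> \<le> 1\<close>, comparison with the
    initial weight, smallness of the near part and size of the loss. \<open>M1\<close> is fixed
    before any solution is given, hence the absolute value; adding 1 keeps the denominators
    positive.\<close>
  define \<beta> where "\<beta> = Min {1, \<alpha>0 powr a, 1 / (2 * (S + 1) * (\<bar>M1\<bar> + 1)), 1 / (972 * (1 + G))}"
  have S: "0 \<le> S" unfolding S_def using assms by (intro mittag_leffler_nonneg) auto
  have G: "0 < G" using assms by (simp add: G_def)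
  have \<beta>: "0 < \<beta>" "\<beta> \<le> 1" "\<beta> \<le> \<alpha>0 powr a" "\<beta> \<le> 1 / (2 * (S + 1) * (\<bar>M1\<bar> + 1))" "\<beta> \<le> 1 / (972 * (1 + G))"
    unfolding \<beta>_def using S G assms by (auto intro!: mult_pos_pos)
  have large: "\<beta> * (972 * (1 + G)) \<le> 1" using \<beta>(5) G by (simp add: pos_le_divide_eq)
  have \<beta>M: "\<beta> * (2 * (S + 1) * (\<bar>M1\<bar> + 1)) \<le> 1"
    using \<beta>(4) S by (subst (asm) pos_le_divide_eq) (auto intro!: mult_pos_pos)
  have "2 * \<beta> * (S * \<bar>M1\<bar>) \<le> 2 * \<beta> * ((S + 1) * (\<bar>M1\<bar> + 1))"
    using S \<beta>(1) by (intro mult_left_mono mult_mono) auto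
  also have "\<dots> \<le> 1" using \<beta>M by (simp add: algebra_simps)
  finally have small: "\<beta> * S * \<bar>M1\<bar> \<le> 1 / 2" by (simp add: ac_simps)
  define \<alpha> where "\<alpha> = \<beta> powr (1 / a)"
  have \<alpha>: "0 < \<alpha>" "\<alpha> powr a = \<beta>" using \<beta>(1) assms by (auto simp: \<alpha>_def powr_powr)
  show ?thesis
  proof (intro exI[of _ \<alpha>] conjI \<alpha>(1) allI impI, elim conjE)
    fix \<kappa>0 C8 c8 C \<delta> h3 hinf :: real and f nc f0 and n0 :: real
    assume \<kappa>0: "0 < \<kappa>0" and h3: "0 < h3" and f0: "f 0 = f0" "energy f0 = M1" "ml_integral a \<alpha>0 f0 \<le> 1"
      and sol: "bec_solution \<kappa>0 {0..} (invariant_set h3 (h8_bound \<kappa>0 \<delta> C8 c8 h3) hinf) f nc"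
    have "f 0 \<in> invariant_set h3 (h8_bound \<kappa>0 \<delta> C8 c8 h3) hinf"
      using sol by (simp add: bec_solution_def)
    \<comment> \<open>The bound on \<open>\<beta>\<close> in terms of \<open>M1\<close> becomes the
      required bound in terms of \<open>h3\<close>.\<close>
    then have "M1 = 4 * pi * h3" using energy_eq f0 h3 by fastforce
    then have "\<beta> * S * (4 * pi * h3) \<le> 1 / 2" using small h3 by (simp add: abs_mult)
    then have "\<beta> * mittag_leffler a 1 * h3 \<le> 1 / (2 * (4 * pi))"
      by (simp add: S_def field_simps)
    then show "(SUP t\<in>{0..}. ml_integral a \<alpha> (f t)) \<le> 2"
      using ml_integral_le[OF assms(2) \<beta>(1-3) \<alpha>(2) _ _ _ \<kappa>0 sol] large h3 f0
      by (intro SUP_least) (auto simp: G_def)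
  qed
qed

end
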